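(* Let $M$ be a complete, locally compact, purely 1-unrectifiable metric space (with an arbitrary base point). Then $\mathcal{F}(M)$ has property (V$^*$).
   Context: A metric space is purely 1-unrectifiable if it contains no bi-Lipschitz copy of a subset of $\mathbb{R}$ with positive (Lebesgue) measure. For a pointed metric space $(M,d)$ with base point $0$, $\mathrm{Lip}_0(M)$ is the real Banach space of Lipschitz functions $f:M\to\mathbb{R}$ with $f(0)=0$, normed by the best Lipschitz constant $\mathrm{Lip}(f)$. For $x\in M$, $\delta(x)\in \mathrm{Lip}_0(M)^*$ is the evaluation $f\mapsto f(x)$. The Lipschitz-free space is $\mathcal{F}(M)=\overline{\mathrm{span}}\,\{\delta(x):x\in M\}\subset\mathrm{Lip}_0(M)^*$ (norm closure); up to linear isometry it does not depend on the base point. A series $\sum_n y_n$ in a Banach space $Y$ is weakly unconditionally Cauchy (WUC) if $\sum_n|\langle y^*,y_n\rangle|<\infty$ for every $y^*\in Y^*$. A subset $\Gamma$ of a Banach space $X$ is a (V$^*$)-set (with respect to $X$) if $\lim_{n\to\infty}\sup_{x\in\Gamma}|\langle x_n^*,x\rangle|=0$ for every WUC series $\sum_n x_n^*$ in $X^*$. $X$ has property (V$^*$) if every (V$^*$)-set with respect to $X$ is relatively weakly compact (its weak closure is weakly compact). *)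

theory Defs
  imports "HOL-Analysis.Analysis"
begin

section \<open>Purely 1-unrectifiable sets\<close>

definition bilipschitz_on :: "'a::metric_space set \<Rightarrow> ('a \<Rightarrow> 'b::metric_space) \<Rightarrow> bool" where
  "bilipschitz_on A g \<longleftrightarrow>
    (\<exists>c>0. \<exists>C. \<forall>x\<in>A. \<forall>y\<in>A. c * dist x y \<le> dist (g x) (g y) \<and> dist (g x) (g y) \<le> C * dist x y)"

definition purely_1_unrectifiable :: "'a::metric_space set \<Rightarrow> bool" where
  "purely_1_unrectifiable M \<longleftrightarrow>
    \<not> (\<exists>(A :: real set) g. A \<in> sets lebesgue \<and> 0 < emeasure lebesgue A \<and>
          g ` A \<subseteq> M \<and> bilipschitz_on A g)"

section \<open>Lipschitz functions vanishing at the base point\<close>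

text \<open>
  The base point is a class parameter, so that the Banach spaces built from a pointed metric
  space are types. The class places no requirement on it.
\<close>

class pointed_metric_space = metric_space +
  fixes base_point :: 'a

typedef (overloaded) ('a::pointed_metric_space) lip0 =
  "{f :: 'a \<Rightarrow> real. f base_point = 0 \<and> (\<exists>C. C-lipschitz_on UNIV f)}"
  morphisms lip0_apply Lip0
  by (rule exI[of _ "\<lambda>_. 0"]) (auto simp: lipschitz_on_def)

setup_lifting type_definition_lip0

lemma lip0_apply_base_point [simp]: "lip0_apply f base_point = 0"
  using lip0_apply[of f] by simp

lemma lip0_apply_lipschitz: "\<exists>C. C-lipschitz_on UNIV (lip0_apply f)"
  using lip0_apply[of f] by simp

lemma lip0_eqI: "(\<And>x. lip0_apply f x = lip0_apply g x) \<Longrightarrow> f = g"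
  by (simp add: lip0_apply_inject[symmetric] fun_eq_iff)

definition best_lipschitz :: "('a::metric_space \<Rightarrow> real) \<Rightarrow> real" where
  "best_lipschitz f = Inf {C. C-lipschitz_on UNIV f}"

lemma best_lipschitz_le:
  assumes "C-lipschitz_on UNIV f" shows "best_lipschitz f \<le> C"
  unfolding best_lipschitz_def
  by (rule cInf_lower) (use assms in \<open>auto intro!: bdd_belowI[of _ 0] dest: lipschitz_on_nonneg\<close>)

lemma best_lipschitz_lipschitz:
  assumes "\<exists>C. C-lipschitz_on UNIV f" shows "(best_lipschitz f)-lipschitz_on UNIV f"
proof (rule lipschitz_onI)
  show "0 \<le> best_lipschitz f"
    unfolding best_lipschitz_def
    by (rule cInf_greatest) (use assms in \<open>auto dest: lipschitz_on_nonneg\<close>)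
  fix x y
  show "dist (f x) (f y) \<le> best_lipschitz f * dist x y"
  proof (cases "x = y")
    case False
    have "dist (f x) (f y) / dist x y \<le> best_lipschitz f"
      unfolding best_lipschitz_def
      by (rule cInf_greatest)
        (use assms False in \<open>auto simp: divide_simps dest: lipschitz_onD[of _ UNIV f x y]\<close>)
    with False show ?thesis by (simp add: divide_simps)
  qed simp
qed

instantiation lip0 :: (pointed_metric_space) real_normed_vector
begin

lift_definition zero_lip0 :: "'a lip0" is "\<lambda>_. 0"
  by (auto simp: lipschitz_on_def)

lift_definition plus_lip0 :: "'a lip0 \<Rightarrow> 'a lip0 \<Rightarrow> 'a lip0" is "\<lambda>f g x. f x + g x"
  by (auto intro: lipschitz_on_add)

lift_definition uminus_lip0 :: "'a lip0 \<Rightarrow> 'a lip0" is "\<lambda>f x. - f x"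
  by (auto simp: lipschitz_on_def dist_minus)

lift_definition minus_lip0 :: "'a lip0 \<Rightarrow> 'a lip0 \<Rightarrow> 'a lip0" is "\<lambda>f g x. f x - g x"
  by (auto intro: lipschitz_on_diff)

lift_definition scaleR_lip0 :: "real \<Rightarrow> 'a lip0 \<Rightarrow> 'a lip0" is "\<lambda>a f x. a * f x"
  by (auto intro: lipschitz_on_cmult_real)

lift_definition norm_lip0 :: "'a lip0 \<Rightarrow> real" is best_lipschitz .

definition dist_lip0 :: "'a lip0 \<Rightarrow> 'a lip0 \<Rightarrow> real" where
  "dist_lip0 f g = norm (f - g)"

definition sgn_lip0 :: "'a lip0 \<Rightarrow> 'a lip0" where
  "sgn_lip0 f = inverse (norm f) *\<^sub>R f"

definition uniformity_lip0 :: "('a lip0 \<times> 'a lip0) filter" where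
  "uniformity_lip0 = (INF e\<in>{0 <..}. principal {(x, y). dist x y < e})"

definition open_lip0 :: "'a lip0 set \<Rightarrow> bool" where
  "open_lip0 S = (\<forall>x\<in>S. \<forall>\<^sub>F (x', y) in uniformity. x' = x \<longrightarrow> y \<in> S)"

lemma norm_lip0_le: "C-lipschitz_on UNIV (lip0_apply f) \<Longrightarrow> norm f \<le> C"
  by transfer (rule best_lipschitz_le)

lemma norm_lip0_lipschitz: "(norm f)-lipschitz_on UNIV (lip0_apply f)"
  by transfer (auto intro!: best_lipschitz_lipschitz)

lemma norm_lip0_scaleR_le: "norm (a *\<^sub>R f) \<le> \<bar>a\<bar> * norm f" for f :: "'a lip0"
  using lipschitz_on_cmult_real[OF norm_lip0_lipschitz, of a f]
  by (intro norm_lip0_le) (simp add: scaleR_lip0.rep_eq)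

instance
proof
  fix f g h :: "'a lip0" and a b :: real
  show "f + g + h = f + (g + h)" by transfer (simp add: algebra_simps)
  show "f + g = g + f" by transfer (simp add: algebra_simps)
  show "0 + f = f" by transfer simp
  show "- f + f = 0" by transfer simp
  show "f - g = f + - g" by transfer simp
  show "a *\<^sub>R (f + g) = a *\<^sub>R f + a *\<^sub>R g" by transfer (simp add: algebra_simps)
  show "(a + b) *\<^sub>R f = a *\<^sub>R f + b *\<^sub>R f" by transfer (simp add: algebra_simps)
  show assoc: "a *\<^sub>R b *\<^sub>R f = (a * b) *\<^sub>R f" for a b and f :: "'a lip0" by transfer (simp add: algebra_simps)
  show one: "1 *\<^sub>R f = f" for f :: "'a lip0" by transfer simp
  show "sgn f = inverse (norm f) *\<^sub>R f" by (rule sgn_lip0_def)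
  show "dist f g = norm (f - g)" by (rule dist_lip0_def)
  show "(uniformity :: ('a lip0 \<times> 'a lip0) filter) =
      (INF e\<in>{0 <..}. principal {(x, y). dist x y < e})"
    by (rule uniformity_lip0_def)
  show "open U = (\<forall>x\<in>U. \<forall>\<^sub>F (x', y) in uniformity. x' = x \<longrightarrow> y \<in> U)" for U :: "'a lip0 set"
    by (rule open_lip0_def)
  have norm_zero: "norm (0 :: 'a lip0) = 0"
  proof (rule antisym)
    show "norm (0 :: 'a lip0) \<le> 0"
      by (rule norm_lip0_le) (simp add: zero_lip0.rep_eq lipschitz_on_def)
    show "0 \<le> norm (0 :: 'a lip0)"
      by (rule lipschitz_on_nonneg[OF norm_lip0_lipschitz])
  qed
  show "norm f = 0 \<longleftrightarrow> f = 0"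
  proof
    assume "norm f = 0"
    then have "lip0_apply f x = 0" for x
      using lipschitz_onD[OF norm_lip0_lipschitz[of f], of x base_point] by simp
    then show "f = 0" by (intro lip0_eqI) (simp add: zero_lip0.rep_eq)
  qed (simp add: norm_zero)
  show "norm (f + g) \<le> norm f + norm g"
    using lipschitz_on_add[OF norm_lip0_lipschitz norm_lip0_lipschitz, of f g]
    by (intro norm_lip0_le) (simp add: plus_lip0.rep_eq)
  show "norm (a *\<^sub>R f) = \<bar>a\<bar> * norm f"
  proof (cases "a = 0")
    case True
    then have "a *\<^sub>R f = 0" by transfer simp
    with True norm_zero show ?thesis by simp
  next
    case False
    have "norm f = norm (inverse a *\<^sub>R a *\<^sub>R f)"
      using False by (simp add: assoc one)
    also have "\<dots> \<le> \<bar>inverse a\<bar> * norm (a *\<^sub>R f)" by (rule norm_lip0_scaleR_le)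
    finally have "\<bar>a\<bar> * norm f \<le> norm (a *\<^sub>R f)"
      using False by (simp add: field_simps)
    then show ?thesis using norm_lip0_scaleR_le[of a f] by simp
  qed
qed

end

section \<open>Lipschitz-free spaces\<close>

lift_definition lip0_delta :: "'a::pointed_metric_space \<Rightarrow> 'a lip0 \<Rightarrow>\<^sub>L real" is
  "\<lambda>x f. lip0_apply f x"
proof (rule bounded_linear_intro)
  fix x :: 'a and f g :: "'a lip0" and a :: real
  show "lip0_apply (f + g) x = lip0_apply f x + lip0_apply g x" by (simp add: plus_lip0.rep_eq)
  show "lip0_apply (a *\<^sub>R f) x = a *\<^sub>R lip0_apply f x" by (simp add: scaleR_lip0.rep_eq)
  show "norm (lip0_apply f x) \<le> norm f * dist x base_point"
    using lipschitz_onD[OF norm_lip0_lipschitz[of f], of x base_point] by simp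
qed

lemma subspace_closure_span: "subspace (closure (span S))"
  for S :: "'a::real_normed_vector set"
proof (rule subspaceI)
  show "0 \<in> closure (span S)"
    using closure_subset[of "span S"] span_zero[of S] by blast
next
  fix x y assume "x \<in> closure (span S)" "y \<in> closure (span S)"
  then obtain u v where "\<forall>n. u n \<in> span S" "u \<longlonglongrightarrow> x" "\<forall>n. v n \<in> span S" "v \<longlonglongrightarrow> y"
    by (auto simp: closure_sequential)
  then show "x + y \<in> closure (span S)"
    unfolding closure_sequential
    by (intro exI[of _ "\<lambda>n. u n + v n"]) (auto intro: span_add tendsto_add)
next
  fix c :: real and x assume "x \<in> closure (span S)"
  then obtain u where "\<forall>n. u n \<in> span S" "u \<longlonglongrightarrow> x"
    by (auto simp: closure_sequential)
  then show "c *\<^sub>R x \<in> closure (span S)"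
    unfolding closure_sequential
    by (intro exI[of _ "\<lambda>n. c *\<^sub>R u n"]) (auto intro: span_scale tendsto_scaleR)
qed

typedef (overloaded) ('a::pointed_metric_space) lipschitz_free =
  "closure (span (range lip0_delta)) :: ('a lip0 \<Rightarrow>\<^sub>L real) set"
  morphisms free_to_dual Lipschitz_free
  using subspace_0[OF subspace_closure_span] by blast

setup_lifting type_definition_lipschitz_free

instantiation lipschitz_free :: (pointed_metric_space) real_normed_vector
begin

lift_definition zero_lipschitz_free :: "'a lipschitz_free" is 0
  by (rule subspace_0[OF subspace_closure_span])

lift_definition plus_lipschitz_free ::
  "'a lipschitz_free \<Rightarrow> 'a lipschitz_free \<Rightarrow> 'a lipschitz_free" is "(+)"
  by (rule subspace_add[OF subspace_closure_span])

lift_definition uminus_lipschitz_free :: "'a lipschitz_free \<Rightarrow> 'a lipschitz_free" is uminus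
  by (rule subspace_neg[OF subspace_closure_span])

lift_definition minus_lipschitz_free ::
  "'a lipschitz_free \<Rightarrow> 'a lipschitz_free \<Rightarrow> 'a lipschitz_free" is "(-)"
  by (rule subspace_diff[OF subspace_closure_span])

lift_definition scaleR_lipschitz_free ::
  "real \<Rightarrow> 'a lipschitz_free \<Rightarrow> 'a lipschitz_free" is scaleR
  by (rule subspace_scale[OF subspace_closure_span])

lift_definition norm_lipschitz_free :: "'a lipschitz_free \<Rightarrow> real" is norm .

definition dist_lipschitz_free :: "'a lipschitz_free \<Rightarrow> 'a lipschitz_free \<Rightarrow> real" where
  "dist_lipschitz_free u v = norm (u - v)"

definition sgn_lipschitz_free :: "'a lipschitz_free \<Rightarrow> 'a lipschitz_free" where
  "sgn_lipschitz_free u = inverse (norm u) *\<^sub>R u"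

definition uniformity_lipschitz_free :: "('a lipschitz_free \<times> 'a lipschitz_free) filter" where
  "uniformity_lipschitz_free = (INF e\<in>{0 <..}. principal {(x, y). dist x y < e})"

definition open_lipschitz_free :: "'a lipschitz_free set \<Rightarrow> bool" where
  "open_lipschitz_free S = (\<forall>x\<in>S. \<forall>\<^sub>F (x', y) in uniformity. x' = x \<longrightarrow> y \<in> S)"

instance
proof
  fix u v w :: "'a lipschitz_free" and a b :: real
  show "u + v + w = u + (v + w)" by transfer (simp add: algebra_simps)
  show "u + v = v + u" by transfer (simp add: algebra_simps)
  show "0 + u = u" by transfer simp
  show "- u + u = 0" by transfer simp
  show "u - v = u + - v" by transfer simp
  show "a *\<^sub>R (u + v) = a *\<^sub>R u + a *\<^sub>R v" by transfer (simp add: algebra_simps)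
  show "(a + b) *\<^sub>R u = a *\<^sub>R u + b *\<^sub>R u" by transfer (simp add: algebra_simps)
  show "a *\<^sub>R b *\<^sub>R u = (a * b) *\<^sub>R u" by transfer simp
  show "1 *\<^sub>R u = u" by transfer simp
  show "sgn u = inverse (norm u) *\<^sub>R u" by (rule sgn_lipschitz_free_def)
  show "dist u v = norm (u - v)" by (rule dist_lipschitz_free_def)
  show "(uniformity :: ('a lipschitz_free \<times> 'a lipschitz_free) filter) =
      (INF e\<in>{0 <..}. principal {(x, y). dist x y < e})"
    by (rule uniformity_lipschitz_free_def)
  show "open U = (\<forall>x\<in>U. \<forall>\<^sub>F (x', y) in uniformity. x' = x \<longrightarrow> y \<in> U)"
    for U :: "'a lipschitz_free set"
    by (rule open_lipschitz_free_def)
  show "norm u = 0 \<longleftrightarrow> u = 0" by transfer simp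
  show "norm (u + v) \<le> norm u + norm v" by transfer (rule norm_triangle_ineq)
  show "norm (a *\<^sub>R u) = \<bar>a\<bar> * norm u" by transfer simp
qed

end

lemma dist_free_to_dual: "dist (free_to_dual u) (free_to_dual v) = dist u v"
  by (simp add: dist_norm norm_lipschitz_free.rep_eq minus_lipschitz_free.rep_eq)

instance lipschitz_free :: (pointed_metric_space) banach
proof
  fix X :: "nat \<Rightarrow> 'a lipschitz_free"
  assume "Cauchy X"
  then have "Cauchy (\<lambda>n. free_to_dual (X n))"
    by (simp add: Cauchy_def dist_free_to_dual)
  then obtain l where l: "(\<lambda>n. free_to_dual (X n)) \<longlonglongrightarrow> l"
    by (auto simp: Cauchy_convergent_iff convergent_def)
  have "l \<in> closure (span (range lip0_delta))"
    by (rule closed_sequentially[OF closed_closure _ l]) (rule free_to_dual)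
  then have "free_to_dual (Lipschitz_free l) = l" by (rule Lipschitz_free_inverse)
  with l have "X \<longlonglongrightarrow> Lipschitz_free l"
    by (simp add: tendsto_dist_iff[of _ l] tendsto_dist_iff[of X] flip: dist_free_to_dual)
  then show "convergent X" by (auto simp: convergent_def)
qed

section \<open>Property (V*)\<close>

definition weak_topology :: "'x::real_normed_vector topology" where
  "weak_topology = pullback_topology UNIV (\<lambda>x (\<phi> :: 'x \<Rightarrow>\<^sub>L real). \<phi> x) euclidean"

definition relatively_weakly_compact :: "'x::real_normed_vector set \<Rightarrow> bool" where
  "relatively_weakly_compact S \<longleftrightarrow> compactin weak_topology (weak_topology closure_of S)"

definition weakly_unconditionally_Cauchy :: "(nat \<Rightarrow> 'y::real_normed_vector) \<Rightarrow> bool" where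
  "weakly_unconditionally_Cauchy y \<longleftrightarrow> (\<forall>\<phi> :: 'y \<Rightarrow>\<^sub>L real. summable (\<lambda>n. \<bar>\<phi> (y n)\<bar>))"

text \<open>
  The supremum is taken in \<^typ>\<open>ennreal\<close>: it is infinite for families that are unbounded
  (where the supremum of reals would be unspecified) and 0 for the empty family.
\<close>

definition V_star_set :: "'x::real_normed_vector set \<Rightarrow> bool" where
  "V_star_set \<Gamma> \<longleftrightarrow>
    (\<forall>\<phi> :: nat \<Rightarrow> 'x \<Rightarrow>\<^sub>L real. weakly_unconditionally_Cauchy \<phi> \<longrightarrow>
      (\<lambda>n. SUP x\<in>\<Gamma>. ennreal \<bar>blinfun_apply (\<phi> n) x\<bar>) \<longlonglongrightarrow> 0)"

definition property_V_star :: "'x::banach itself \<Rightarrow> bool" where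
  "property_V_star _ \<longleftrightarrow> (\<forall>\<Gamma> :: 'x set. V_star_set \<Gamma> \<longrightarrow> relatively_weakly_compact \<Gamma>)"

end

theory Submission
  imports Defs
begin

text \<open>
  Every (V*)-set \<open>\<Gamma>\<close> is shown to be totally bounded in norm, by gliding humps: a sequence \<open>f\<^sub>n\<close>
  in \<open>Lip\<^sub>0(M)\<close> with \<open>\<Sum>\<^sub>n \<bar>f\<^sub>n x - f\<^sub>n y\<bar> \<le> C d(x, y)\<close> gives a WUC series, so it tends to 0 uniformly on \<open>\<Gamma>\<close>.
  Humps with disjoint supports show that \<open>\<Gamma>\<close> is concentrated near finite sets at every scale and,
  by local compactness, on a compact set \<open>A\<close>.

  On \<open>A\<close>, were \<open>\<Gamma>\<close> not totally bounded, one could choose differences of elements of \<open>\<Gamma>\<close> that are far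
  from 0 but nearly vanish on a finite sup-norm net of the unit ball, hence are detected by functions of
  small sup-norm. If these functions are moreover little Lipschitz, then at a given pair of points at
  most one of them has a difference comparable to the distance: the later ones are too small, the
  earlier ones too flat.

  Pure 1-unrectifiability makes the little Lipschitz functions uniformly dense: a 1-Lipschitz function
  is flattened by the infimal convolution with a chain distance in which short steps are almost
  free. If that changed the function much at all scales, chains of short steps would cover a set of
  values of positive measure, and a limit of their well-behaved parts would be a bi-Lipschitz copy
  of such a set.
\<close>

section \<open>Bi-Lipschitz curve fragments\<close>

text \<open>
  By Tychonoff's theorem. It replaces Hausdorff convergence of a subsequence of finite sets when it is
  applied to their distance functions.
\<close>

lemma bounded_functions_cluster:
  fixes r :: "nat \<Rightarrow> 'b \<Rightarrow> real"
  assumes "\<And>n z. \<bar>r n z\<bar> \<le> B"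
  obtains \<phi> where "\<And>F e. finite F \<Longrightarrow> 0 < e \<Longrightarrow> \<exists>\<^sub>F n in sequentially. \<forall>z\<in>F. \<bar>r n z - \<phi> z\<bar> < e"
proof -
  let ?K = "PiE UNIV (\<lambda>_ :: 'b. {-B..B})"
  have "compactin (product_topology (\<lambda>_. euclidean) UNIV) ?K"
    unfolding compactin_PiE by auto
  then have "compact ?K"
    by (simp flip: compactin_euclidean_iff euclidean_product_topology)
  moreover have "eventually (\<lambda>f. f \<in> ?K) (filtermap r sequentially)"
  proof -
    have "r n z \<in> {-B..B}" for n z
      using assms[of n z] by auto
    then have "r n \<in> ?K" for n by (simp add: PiE_iff)
    then show ?thesis by (simp add: eventually_filtermap)
  qed
  ultimately obtain \<phi> where \<phi>: "inf (nhds \<phi>) (filtermap r sequentially) \<noteq> bot"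
    by (metis compact_filter filtermap_bot_iff sequentially_bot)
  show thesis
  proof (rule that)
    fix F :: "'b set" and e :: real
    assume "finite F" "0 < e"
    have "\<forall>\<^sub>F f in nhds \<phi>. dist (f z) (\<phi> z) < e" for z
    proof -
      have "open ((\<lambda>f. f z) -` ball (\<phi> z) e :: ('b \<Rightarrow> real) set)"
        using continuous_on_product_coordinates by (intro open_vimage) (auto simp: continuous_on_product_coordinates)
      then show ?thesis
        using \<open>0 < e\<close> unfolding eventually_nhds by (auto intro!: exI simp: dist_commute)
    qed
    then have ev: "\<forall>\<^sub>F f in nhds \<phi>. \<forall>z\<in>F. dist (f z) (\<phi> z) < e"
      using \<open>finite F\<close> by (simp add: eventually_ball_finite)
    show "\<exists>\<^sub>F n in sequentially. \<forall>z\<in>F. \<bar>r n z - \<phi> z\<bar> < e"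
    proof (rule ccontr)
      assume "\<not> (\<exists>\<^sub>F n in sequentially. \<forall>z\<in>F. \<bar>r n z - \<phi> z\<bar> < e)"
      then have "\<forall>\<^sub>F f in filtermap r sequentially. \<not> (\<forall>z\<in>F. dist (f z) (\<phi> z) < e)"
        by (simp add: frequently_def eventually_filtermap dist_real_def)
      with ev have "\<forall>\<^sub>F f in inf (nhds \<phi>) (filtermap r sequentially). False"
        unfolding eventually_inf by blast
      with \<phi> show False by (simp add: trivial_limit_def)
    qed
  qed
qed

text \<open>A curve fragment as a set of pairs of a value and a point where it is taken. Unlike a
  map, such a relation passes to limits of finite sets. The lower constant is 1 because the values
  come from a 1-Lipschitz function.\<close>

definition bilip_pairs :: "real \<Rightarrow> (real \<times> 'a::metric_space) set \<Rightarrow> bool" where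
  "bilip_pairs C P \<longleftrightarrow> (\<forall>(u, p)\<in>P. \<forall>(v, q)\<in>P. \<bar>u - v\<bar> \<le> dist p q \<and> dist p q \<le> C * \<bar>u - v\<bar>)"

text \<open>The bounds make \<open>G\<close> the graph of a map from its first projection into
  \<open>A\<close>, bi-Lipschitz with constants 1 and \<open>C\<close>; positive measure would
  contradict unrectifiability.\<close>

lemma bilip_pairs_null:
  fixes A :: "'a::metric_space set"
  assumes "compact A" "purely_1_unrectifiable A" "bilip_pairs C G" "compact G" "snd ` G \<subseteq> A"
  shows "measure lebesgue (fst ` G) = 0"
proof (rule ccontr)
  assume nz: "measure lebesgue (fst ` G) \<noteq> 0"
  have cV: "compact (fst ` G)"
    using \<open>compact G\<close> by (intro compact_continuous_image continuous_intros)
  define g where "g v = (SOME p. (v, p) \<in> G)" for v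
  have g: "(v, g v) \<in> G" if "v \<in> fst ` G" for v
    unfolding g_def by (rule someI_ex) (use that in auto)
  have "bilipschitz_on (fst ` G) g"
    unfolding bilipschitz_on_def
  proof (rule exI[of _ 1], rule conjI, simp, rule exI[of _ C], intro ballI conjI)
    fix u v assume "u \<in> fst ` G" "v \<in> fst ` G"
    then have "(u, g u) \<in> G" "(v, g v) \<in> G" by (simp_all add: g)
    with assms(3) show "1 * dist u v \<le> dist (g u) (g v)" "dist (g u) (g v) \<le> C * dist u v"
      by (auto simp: bilip_pairs_def dist_real_def)
  qed
  moreover have "g ` fst ` G \<subseteq> A"
    using g assms(5) by force
  moreover have "0 < emeasure lebesgue (fst ` G)"
    using nz by (metis bot.not_eq_extremum bot_ennreal enn2real_0 measure_def)
  ultimately show False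
    using assms(2) lmeasurable_compact[OF cV] unfolding purely_1_unrectifiable_def
    by (meson fmeasurableD)
qed

text \<open>Compactness. Counterexamples \<open>P n\<close> at scales tending to 0 have a limit set
  \<open>G\<close> with the same bounds, so its projection is null and lies in an open
  \<open>W\<close> of measure below \<open>\<eta>\<close>. For some large \<open>n\<close> the
  thickened projection of \<open>P n\<close> lies in \<open>W\<close> too.\<close>

lemma bilip_pairs_small:
  fixes A :: "'a::metric_space set"
  assumes A: "compact A" "purely_1_unrectifiable A" and C: "0 \<le> C" and \<eta>: "0 < \<eta>"
  shows "\<exists>\<delta>>0. \<forall>P. finite P \<longrightarrow> P \<subseteq> {-R..R} \<times> A \<longrightarrow> bilip_pairs C P \<longrightarrow>
           measure lebesgue (\<Union>v\<in>fst ` P. {v..v + \<delta>}) < \<eta>"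
proof (rule ccontr)
  assume neg: "\<not> ?thesis"
  define \<delta> where "\<delta> n = inverse (real (Suc n))" for n
  have \<delta>: "0 < \<delta> n" "\<delta> n \<le> 1" for n
    by (auto simp: \<delta>_def divide_simps)
  have "\<exists>P. finite P \<and> P \<subseteq> {-R..R} \<times> A \<and> bilip_pairs C P \<and>
        \<eta> \<le> measure lebesgue (\<Union>v\<in>fst ` P. {v..v + \<delta> n})" for n
    using neg \<delta>(1)[of n] by (meson not_less)
  then obtain P where P: "finite (P n)" "P n \<subseteq> {-R..R} \<times> A" "bilip_pairs C (P n)"
      "\<eta> \<le> measure lebesgue (\<Union>v\<in>fst ` P n. {v..v + \<delta> n})" for n
    by metis
  have ne: "P n \<noteq> {}" for n
    using P(4)[of n] \<eta> by auto
  \<comment> \<open>The extra unit leaves room for the thickening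
    \<open>{v..v + \<delta> n}\<close>, as \<open>\<delta> n \<le> 1\<close>.\<close>
  let ?Z = "{-R..R + 1} \<times> A"
  have cZ: "compact ?Z"
    using A(1) by (intro compact_Times) auto
  have PZ: "P n \<subseteq> ?Z" for n
    using P(2)[of n] by auto
  \<comment> \<open>The value 0 outside \<open>?Z\<close> makes these distance functions uniformly
    bounded on the whole type, as \<open>bounded_functions_cluster\<close> requires.\<close>
  define r where "r n z = (if z \<in> ?Z then infdist z (P n) else 0)" for n z
  have r_bound: "\<bar>r n z\<bar> \<le> diameter ?Z" for n z
  proof -
    obtain w where "w \<in> P n" using ne by blast
    then show ?thesis
      using infdist_le[of w "P n" z] diameter_bounded_bound[of ?Z z w] PZ[of n] cZ
        diameter_ge_0[of ?Z]
      by (auto simp: r_def infdist_nonneg compact_imp_bounded intro: order_trans)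
  qed
  obtain \<phi> where \<phi>: "\<And>F e. finite F \<Longrightarrow> 0 < e \<Longrightarrow> \<exists>\<^sub>F n in sequentially. \<forall>z\<in>F. \<bar>r n z - \<phi> z\<bar> < e"
    using bounded_functions_cluster[of r, OF r_bound] by blast
  have ex: "\<exists>n\<ge>N. \<forall>z\<in>F. \<bar>r n z - \<phi> z\<bar> < e" if "finite F" "0 < e" for F e N
    using \<phi>[OF that] by (auto simp: frequently_sequentially)
  have \<phi>_lip: "\<bar>\<phi> x - \<phi> y\<bar> \<le> dist x y" if "x \<in> ?Z" "y \<in> ?Z" for x y
  proof (rule field_le_epsilon)
    fix e :: real assume "0 < e"
    then obtain n where n: "\<forall>z\<in>{x,y}. \<bar>r n z - \<phi> z\<bar> < e/2"
      using ex[of "{x,y}" "e/2"] by auto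
    have "\<bar>r n x - r n y\<bar> \<le> dist x y"
      using that infdist_triangle_abs[of x "P n" y] by (simp add: r_def)
    moreover have "\<bar>r n x - \<phi> x\<bar> < e/2" "\<bar>r n y - \<phi> y\<bar> < e/2"
      using n by auto
    ultimately show "\<bar>\<phi> x - \<phi> y\<bar> \<le> dist x y + e" by arith
  qed
  have \<phi>_cont: "continuous_on ?Z \<phi>"
    unfolding continuous_on_iff
  proof (intro ballI allI impI)
    fix x e assume "x \<in> ?Z" "(0::real) < e"
    then show "\<exists>d>0. \<forall>x'\<in>?Z. dist x' x < d \<longrightarrow> dist (\<phi> x') (\<phi> x) < e"
      by (intro exI[of _ e]) (auto simp only: dist_real_def intro: le_less_trans[OF \<phi>_lip])
  qed
  have \<phi>_nonneg: "0 \<le> \<phi> z" for z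
  proof (rule field_le_epsilon)
    fix e :: real assume "0 < e"
    then obtain n where "\<bar>r n z - \<phi> z\<bar> < e" using ex[of "{z}" e] by auto
    moreover have "0 \<le> r n z" by (simp add: r_def infdist_nonneg)
    ultimately show "0 \<le> \<phi> z + e" by simp
  qed
  \<comment> \<open>The zero set of the cluster point plays the role of the limit of the sets
    \<open>P n\<close>.\<close>
  define G where "G = {z \<in> ?Z. \<phi> z = 0}"
  \<comment> \<open>A cluster point controls only finitely many points at a time, and only for some
    large \<open>n\<close>. Two points suffice for the bounds on \<open>G\<close>.\<close>
  have near: "\<exists>n\<ge>N. \<forall>z\<in>F. \<exists>w\<in>P n. dist z w < e" if F: "finite F" "F \<subseteq> G" "0 < e" for F e N
  proof -
    obtain n where "n \<ge> N" and n: "\<forall>z\<in>F. \<bar>r n z - \<phi> z\<bar> < e"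
      using ex[OF F(1,3)] by blast
    have "\<exists>w\<in>P n. dist z w < e" if "z \<in> F" for z
    proof -
      have "infdist z (P n) < e"
      proof -
        have "z \<in> ?Z" "\<phi> z = 0" "\<bar>r n z - \<phi> z\<bar> < e"
          using n that F(2) by (auto simp: G_def)
        then show ?thesis by (simp add: r_def)
      qed
      then show ?thesis
        using ne[of n] by (simp add: infdist_notempty cINF_less_iff)
    qed
    with \<open>n \<ge> N\<close> show ?thesis by blast
  qed
  have cG: "compact G"
  proof -
    have "closed G" unfolding G_def
      by (rule continuous_closed_preimage_constant[OF \<phi>_cont compact_imp_closed[OF cZ]])
    then show ?thesis using cZ
      by (metis (no_types, lifting) G_def compact_Int_closed inf.absorb_iff2 mem_Collect_eq subsetI)
  qed
  have bG: "bilip_pairs C G"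
    unfolding bilip_pairs_def
  proof clarify
    fix u p v q assume z: "(u, p) \<in> G" "(v, q) \<in> G"
    have *: "\<bar>u - v\<bar> \<le> dist p q + 4 * e \<and> dist p q \<le> C * \<bar>u - v\<bar> + (2 + 2 * C) * e" if "0 < e" for e
    proof -
      obtain n where n: "\<forall>z\<in>{(u,p),(v,q)}. \<exists>w\<in>P n. dist z w < e"
        using near[of "{(u,p),(v,q)}" e 0] z \<open>0 < e\<close> by auto
      then obtain u' p' v' q' where w: "(u',p') \<in> P n" "(v',q') \<in> P n"
          "dist (u,p) (u',p') < e" "dist (v,q) (v',q') < e"
        by (metis insertI1 insertI2 surj_pair)
      have d: "\<bar>u - u'\<bar> < e" "dist p p' < e" "\<bar>v - v'\<bar> < e" "dist q q' < e"
        using w(3,4) dist_fst_le[of "(u,p)" "(u',p')"] dist_snd_le[of "(u,p)" "(u',p')"]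
          dist_fst_le[of "(v,q)" "(v',q')"] dist_snd_le[of "(v,q)" "(v',q')"]
        by (auto simp: dist_real_def)
      have b: "\<bar>u' - v'\<bar> \<le> dist p' q'" "dist p' q' \<le> C * \<bar>u' - v'\<bar>"
        using P(3)[of n] w(1,2) by (auto simp: bilip_pairs_def)
      have t: "dist p' q' \<le> dist p q + 2 * e" "dist p q \<le> dist p' q' + 2 * e"
        using d dist_triangle[of p' q' p] dist_triangle[of p q' q]
          dist_triangle[of p q p'] dist_triangle[of p' q q']
        by (auto simp: dist_commute)
      have "C * \<bar>u' - v'\<bar> \<le> C * (\<bar>u - v\<bar> + 2 * e)"
        using C d by (intro mult_left_mono) auto
      then show ?thesis
        using b t d by (simp add: algebra_simps)
    qed
    show "\<bar>u - v\<bar> \<le> dist p q \<and> dist p q \<le> C * \<bar>u - v\<bar>"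
    proof
      show "\<bar>u - v\<bar> \<le> dist p q"
        by (rule field_le_epsilon) (use *[of "e / 4" for e] in auto)
      show "dist p q \<le> C * \<bar>u - v\<bar>"
      proof (rule field_le_epsilon)
        fix e :: real assume "0 < e"
        then have "(2 + 2 * C) * (e / (2 + 2 * C)) = e" "0 < e / (2 + 2 * C)"
          using C by (auto simp: add_pos_nonneg)
        then show "dist p q \<le> C * \<bar>u - v\<bar> + e"
          using *[of "e / (2 + 2 * C)"] by simp
      qed
    qed
  qed
  have cV: "compact (fst ` G)"
    using cG by (intro compact_continuous_image continuous_intros)
  have V0: "measure lebesgue (fst ` G) = 0"
    by (rule bilip_pairs_null[OF A bG cG]) (auto simp: G_def)
  obtain W where W: "open W" "fst ` G \<subseteq> W" "W - fst ` G \<in> lmeasurable"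
      "emeasure lebesgue (W - fst ` G) < ennreal \<eta>"
    using sets_lebesgue_outer_open[OF fmeasurableD[OF lmeasurable_compact[OF cV]] \<eta>] by blast
  have W_eq: "W = (W - fst ` G) \<union> fst ` G"
    using W(2) by auto
  have W_meas: "W \<in> lmeasurable"
    using W(3) lmeasurable_compact[OF cV] by (subst W_eq) (rule fmeasurable.Un)
  have "measure lebesgue W \<le> measure lebesgue (W - fst ` G) + measure lebesgue (fst ` G)"
    using measure_Un_le[of "W - fst ` G" lebesgue "fst ` G"] W(3) lmeasurable_compact[OF cV] W_eq
    by (metis fmeasurableD)
  moreover have "measure lebesgue (W - fst ` G) < \<eta>"
    using W(3,4) \<eta> by (simp add: emeasure_eq_measure2 ennreal_less_iff)
  ultimately have W_less: "measure lebesgue W < \<eta>"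
    using V0 by simp
  \<comment> \<open>On \<open>H\<close> the limit distance \<open>\<phi>\<close> is bounded away
    from 0, since its zeros project into \<open>W\<close>.\<close>
  define H where "H = ?Z - W \<times> UNIV"
  have cH: "compact H"
    unfolding H_def using cZ W(1) by (intro compact_diff open_Times) auto
  obtain \<kappa> where \<kappa>: "0 < \<kappa>" "\<And>z. z \<in> H \<Longrightarrow> 3 * \<kappa> \<le> \<phi> z"
  proof (cases "H = {}")
    case False
    have "continuous_on H \<phi>"
      using \<phi>_cont by (rule continuous_on_subset) (auto simp: H_def)
    then obtain z where z: "z \<in> H" "\<forall>y\<in>H. \<phi> z \<le> \<phi> y"
      using continuous_attains_inf[OF cH False] by blast
    then have "\<phi> z \<noteq> 0" 
    proof (intro notI)
      assume "\<phi> z = 0"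
      with z(1) have "z \<in> G" by (simp add: G_def H_def)
      then have "fst z \<in> W" using W(2) by blast
      with z(1) show False by (auto simp: H_def)
    qed
    with \<phi>_nonneg[of z] z that[of "\<phi> z / 3"] show thesis by simp
  qed (use that[of 1] in auto)
  \<comment> \<open>A finite net transfers the bound from \<open>\<phi>\<close> to
    \<open>r n\<close>: it gives \<open>r n z > 2 * \<kappa>\<close> on \<open>F\<close> and, by the
    1-Lipschitz property, \<open>r n z > \<kappa>\<close> on \<open>H\<close>, whereas thickened
    points have distance at most \<open>\<delta> n < \<kappa>\<close> from
    \<open>P n\<close>.\<close>
  obtain F where F: "finite F" "F \<subseteq> H" "H \<subseteq> (\<Union>z\<in>F. ball z \<kappa>)"
    using cH \<kappa>(1) by (metis compact_eq_seq_compact_metric seq_compact_imp_totally_bounded)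
  obtain N where N: "\<delta> N < \<kappa>" "\<And>n. n \<ge> N \<Longrightarrow> \<delta> n \<le> \<delta> N"
    using reals_Archimedean[OF \<kappa>(1)] by (auto simp: \<delta>_def le_imp_inverse_le)
  obtain n where n: "n \<ge> N" "\<forall>z\<in>F. \<bar>r n z - \<phi> z\<bar> < \<kappa>"
    using ex[OF F(1) \<kappa>(1)] by blast
  have sub: "(\<Union>v\<in>fst ` P n. {v..v + \<delta> n}) \<subseteq> W"
  proof clarify
    fix v p t assume vp: "(v, p) \<in> P n" and t: "t \<in> {fst (v, p)..fst (v, p) + \<delta> n}"
    show "t \<in> W"
    proof (rule ccontr)
      assume "t \<notin> W"
      then have tH: "(t, p) \<in> H"
        using vp t P(2)[of n] \<delta>(2)[of n] by (auto simp: H_def)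
      then obtain z where z: "z \<in> F" "dist z (t, p) < \<kappa>"
        using F(3) by auto
      have "2 * \<kappa> < r n z"
        using n(2) z(1) \<kappa>(2)[of z] F(2) by fastforce
      moreover have "\<bar>r n z - r n (t, p)\<bar> \<le> dist z (t, p)"
        using z(1) F(2) tH infdist_triangle_abs[of z "P n" "(t,p)"] by (auto simp: r_def H_def)
      moreover have "r n (t, p) \<le> \<delta> n"
        using infdist_le[OF vp, of "(t, p)"] t tH by (auto simp: r_def dist_Pair_Pair dist_real_def H_def)
      ultimately show False
        using z(2) N n(1) by (smt (verit))
    qed
  qed
  have "measure lebesgue (\<Union>v\<in>fst ` P n. {v..v + \<delta> n}) \<le> measure lebesgue W"
    using sub W_meas P(1)[of n] by (intro measure_mono_fmeasurable) auto
  with P(4)[of n] W_less show False by simp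
qed

section \<open>Flattening Lipschitz functions\<close>

text \<open>
  Long steps cost \<open>\<bar>f u - f v\<bar>\<close> rather than \<open>dist u v\<close>, so that flattening never increases a difference
  beyond \<open>\<epsilon> * dist u v\<close>; this is what allows the flattening to be iterated with smaller and smaller \<open>\<epsilon>\<close>.
\<close>

definition step_cost :: "('a::metric_space \<Rightarrow> real) \<Rightarrow> real \<Rightarrow> real \<Rightarrow> 'a \<Rightarrow> 'a \<Rightarrow> real" where
  "step_cost f \<epsilon> \<delta> u v =
    (if dist u v \<le> \<delta> then \<epsilon> * dist u v else max \<bar>f u - f v\<bar> (\<epsilon> * dist u v))"

lemma step_cost_ge: "\<epsilon> * dist u v \<le> step_cost f \<epsilon> \<delta> u v"
  by (simp add: step_cost_def)

lemma step_cost_le: "step_cost f \<epsilon> \<delta> u v \<le> max \<bar>f u - f v\<bar> (\<epsilon> * dist u v)"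
  by (simp add: step_cost_def)

lemma step_cost_commute: "step_cost f \<epsilon> \<delta> u v = step_cost f \<epsilon> \<delta> v u"
  by (simp add: step_cost_def dist_commute abs_minus_commute)

section \<open>Chains of steps and the values they cover\<close>

lemma dist_le_sum_steps:
  assumes "i \<le> j"
  shows "dist (p i) (p j) \<le> (\<Sum>k<j. dist (p k) (p (Suc k))) - (\<Sum>k<i. dist (p k) (p (Suc k)))"
  using assms
proof (induction j rule: dec_induct)
  case (step n)
  then show ?case using dist_triangle[of "p i" "p (Suc n)" "p n"] by simp
qed simp

text \<open>
  A discrete rising sun lemma: \<open>w i\<close> is the increment at \<open>i\<close> of the future minimum of \<open>F - s / C\<close>, which
  moves only at the good indices.
\<close>

lemma future_min_covering:
  fixes F s :: "nat \<Rightarrow> real" and N :: nat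
  assumes C: "0 < C" and s: "mono s"
  defines "\<psi> \<equiv> \<lambda>i. F i - s i / C"
  defines "good \<equiv> {i. i < N \<and> (\<forall>j\<in>{i..N}. \<psi> i \<le> \<psi> j)}"
  obtains w where "\<And>i. 0 \<le> w i" "\<And>i. i \<in> good \<Longrightarrow> w i \<le> F (Suc i) - F i"
    "pairwise (\<lambda>i j. disjnt {F i..<F i + w i} {F j..<F j + w j}) good"
    "F N - F 0 \<le> s N / C - s 0 / C + (\<Sum>i\<in>good. w i)"
proof -
  define m where "m i = Min (\<psi> ` {i..N})" for i
  have m_le: "m i \<le> \<psi> j" if "i \<le> j" "j \<le> N" for i j
    unfolding m_def using that by (intro Min_le) auto
  have m_Suc: "m i = min (\<psi> i) (m (Suc i))" if "i < N" for i
  proof -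
    have *: "{i..N} = insert i {Suc i..N}" using that by auto
    show ?thesis unfolding m_def
      by (subst *, unfold image_insert, rule Min_insert) (use that in auto)
  qed
  have m_good: "m i = \<psi> i" if "i \<in> good" for i
    using that unfolding m_def good_def by (intro Min_eqI) auto
  have m_bad: "m (Suc i) = m i" if "i < N" "i \<notin> good" for i
  proof (rule ccontr)
    assume "m (Suc i) \<noteq> m i"
    then have "m i = \<psi> i" using m_Suc[OF that(1)] by (auto simp: min_def split: if_splits)
    with m_le[of i] that show False by (auto simp: good_def)
  qed
  define w where "w i = (if i < N then m (Suc i) - m i else 0)" for i
  show thesis
  proof
    show "0 \<le> w i" for i
      using m_Suc[of i] by (auto simp: w_def)
    show "w i \<le> F (Suc i) - F i" if "i \<in> good" for i
    proof -
      have "w i = m (Suc i) - \<psi> i"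
        using that m_good[OF that] by (simp add: w_def good_def)
      also have "\<dots> \<le> \<psi> (Suc i) - \<psi> i"
        using that m_le[of "Suc i" "Suc i"] by (auto simp: good_def)
      also have "\<dots> \<le> F (Suc i) - F i"
        using C monoD[OF s, of i "Suc i"] by (simp add: \<psi>_def divide_right_mono)
      finally show ?thesis .
    qed
    \<comment> \<open>\<open>m (Suc i)\<close> is at most \<open>\<psi> j\<close>; passing from
      \<open>\<psi>\<close> back to \<open>F\<close> only helps, because \<open>s\<close>
      increases.\<close>
    have next_le: "F i + w i \<le> F j" if "i \<in> good" "j \<in> good" "i < j" for i j
    proof -
      have "w i = m (Suc i) - \<psi> i"
        using that m_good[OF that(1)] by (simp add: w_def good_def)
      moreover have "m (Suc i) \<le> \<psi> j"
        using that by (intro m_le) (auto simp: good_def)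
      moreover have "s i / C \<le> s j / C"
        using C monoD[OF s, of i j] that by (simp add: divide_right_mono)
      ultimately show ?thesis by (simp add: \<psi>_def)
    qed
    show "pairwise (\<lambda>i j. disjnt {F i..<F i + w i} {F j..<F j + w j}) good"
    proof (rule pairwiseI)
      fix i j assume "i \<in> good" "j \<in> good" "i \<noteq> j"
      then consider "F i + w i \<le> F j" | "F j + w j \<le> F i"
        using next_le by (meson linorder_neqE_nat)
      then show "disjnt {F i..<F i + w i} {F j..<F j + w j}"
        by cases (auto simp: disjnt_def)
    qed
    \<comment> \<open>The future minimum agrees with \<open>\<psi>\<close> at \<open>N\<close> and
      is at most \<open>\<psi>\<close> at 0, so its telescoped increments dominate the total
      increase of \<open>\<psi>\<close>.\<close>
    have "F N - F 0 - (s N / C - s 0 / C) = \<psi> N - \<psi> 0"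
      by (simp add: \<psi>_def)
    also have "\<dots> \<le> m N - m 0"
      using m_le[of 0 0] by (simp add: m_def)
    also have "\<dots> = (\<Sum>i<N. m (Suc i) - m i)"
      by (simp add: sum_lessThan_telescope)
    also have "\<dots> = (\<Sum>i<N. w i)"
      by (simp add: w_def)
    also have "\<dots> = (\<Sum>i\<in>good. w i)"
      by (rule sum.mono_neutral_right) (auto simp: good_def w_def dest: m_bad[unfolded good_def])
    finally show "F N - F 0 \<le> s N / C - s 0 / C + (\<Sum>i\<in>good. w i)" by simp
  qed
qed

text \<open>A violating chain has total cost at most \<open>2 * R\<close>, hence bounded length, and
  loses at most \<open>\<eta> / 2\<close> through \<open>s N / C\<close> in
  \<open>future_min_covering\<close>. The remaining increase falls on good indices. Long steps there
  are paid for by their cost; short ones form \<open>bilip_pairs C\<close>, so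
  \<open>bilip_pairs_small\<close> bounds their share by \<open>\<eta> / 2\<close>.\<close>

lemma chain_bound:
  fixes A :: "'a::metric_space set"
  assumes A: "compact A" "purely_1_unrectifiable A"
    and f: "\<And>x y. x \<in> A \<Longrightarrow> y \<in> A \<Longrightarrow> \<bar>f x - f y\<bar> \<le> dist x y"
    and \<epsilon>: "0 < \<epsilon>" and \<eta>: "0 < \<eta>"
  shows "\<exists>\<delta>>0. \<forall>p N. (\<forall>i\<le>N. p i \<in> A) \<longrightarrow>
    f (p N) - f (p 0) \<le> \<eta> + (\<Sum>i<N. step_cost f \<epsilon> \<delta> (p i) (p (Suc i)))"
proof -
  have "bounded (f ` A)"
  proof (intro compact_imp_bounded compact_continuous_image A(1))
    show "continuous_on A f"
      by (rule lipschitz_on_continuous_on[of 1]) (auto simp: lipschitz_on_def dist_real_def f)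
  qed
  then obtain R0 where R0: "\<And>x. x \<in> A \<Longrightarrow> \<bar>f x\<bar> \<le> R0"
    by (auto simp: bounded_real)
  define R where "R = max R0 0"
  have R: "\<bar>f x\<bar> \<le> R" if "x \<in> A" for x
    using R0[OF that] by (simp add: R_def)
  \<comment> \<open>Chosen so that length at most \<open>2 * R / \<epsilon>\<close> gives
    \<open>s N / C \<le> \<eta> / 2\<close>; the summand 1 keeps \<open>C\<close> positive when
    \<open>R = 0\<close>.\<close>
  define C where "C = 4 * R / (\<epsilon> * \<eta>) + 1"
  have C: "0 < C"
    unfolding C_def using \<epsilon> \<eta> by (intro add_nonneg_pos) (auto simp: R_def)
  obtain \<delta> where \<delta>: "0 < \<delta>" and small: "\<And>P. finite P \<Longrightarrow> P \<subseteq> {-R..R} \<times> A \<Longrightarrow> bilip_pairs C P \<Longrightarrow>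
      measure lebesgue (\<Union>v\<in>fst ` P. {v..v + \<delta>}) < \<eta> / 2"
    using bilip_pairs_small[OF A, of C "\<eta> / 2" R] C \<eta> by auto
  have "f (p N) - f (p 0) \<le> \<eta> + (\<Sum>i<N. step_cost f \<epsilon> \<delta> (p i) (p (Suc i)))"
    if p: "\<And>i. i \<le> N \<Longrightarrow> p i \<in> A" for p N
  proof (rule ccontr)
    assume neg: "\<not> ?thesis"
    define F where "F i = f (p i)" for i
    define s where "s i = (\<Sum>k<i. dist (p k) (p (Suc k)))" for i
    define cost where "cost i = step_cost f \<epsilon> \<delta> (p i) (p (Suc i))" for i
    have big: "\<eta> + (\<Sum>i<N. cost i) < F N - F 0"
      using neg by (simp add: F_def cost_def)
    have cost_nonneg: "0 \<le> cost i" for i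
      unfolding cost_def using \<epsilon> by (intro order_trans[OF _ step_cost_ge]) simp
    have "\<epsilon> * s N \<le> (\<Sum>i<N. cost i)"
      unfolding s_def sum_distrib_left cost_def by (intro sum_mono step_cost_ge)
    also have "\<dots> \<le> 2 * R"
      using big \<eta> R[OF p[of N]] R[OF p[of 0]] by (simp add: F_def)
    finally have "s N \<le> 2 * R / \<epsilon>" using \<epsilon> by (simp add: field_simps)
    also have "\<dots> \<le> \<eta> / 2 * C"
      using \<epsilon> \<eta> by (simp add: C_def field_simps)
    finally have sN: "s N / C \<le> \<eta> / 2"
      using C by (simp add: divide_le_eq)
    have s: "mono s"
      unfolding s_def by (intro monoI sum_mono2) auto
    define good where "good = {i. i < N \<and> (\<forall>j\<in>{i..N}. F i - s i / C \<le> F j - s j / C)}"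
    obtain w where w: "\<And>i. 0 \<le> w i" "\<And>i. i \<in> good \<Longrightarrow> w i \<le> F (Suc i) - F i"
      "pairwise (\<lambda>i j. disjnt {F i..<F i + w i} {F j..<F j + w j}) good"
      "F N - F 0 \<le> s N / C - s 0 / C + (\<Sum>i\<in>good. w i)"
      using future_min_covering[OF C s, of N F] unfolding good_def by blast
    have fin: "finite good" by (simp add: good_def)
    define good' where "good' = {i \<in> good. dist (p i) (p (Suc i)) \<le> \<delta>}"
    define P where "P = (\<lambda>i. (F i, p i)) ` good'"
    have fin': "finite good'" using fin by (simp add: good'_def)
    have "bilip_pairs C P"
    proof -
      have *: "\<bar>F i - F j\<bar> \<le> dist (p i) (p j) \<and> dist (p i) (p j) \<le> C * \<bar>F i - F j\<bar>"
        if "i \<in> good'" "j \<in> good'" "i \<le> j" for i j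
      proof
        show "\<bar>F i - F j\<bar> \<le> dist (p i) (p j)"
          unfolding F_def using that by (intro f p) (auto simp: good'_def good_def)
        have "dist (p i) (p j) \<le> s j - s i"
          unfolding s_def by (rule dist_le_sum_steps[OF that(3)])
        \<comment> \<open>Goodness of \<open>i\<close>, tested at \<open>j\<close>, bounds the chain
          length between them by \<open>C\<close> times the increase of \<open>F\<close>.\<close>
        also have "s j - s i \<le> C * (F j - F i)"
        proof -
          have "F i - s i / C \<le> F j - s j / C"
            using that by (auto simp: good'_def good_def)
          then have "(s j - s i) / C \<le> F j - F i"
            by (simp add: diff_divide_distrib)
          then show ?thesis
            using C by (simp add: pos_divide_le_eq mult.commute)
        qed
        also have "\<dots> \<le> C * \<bar>F i - F j\<bar>"
          using C by (intro mult_left_mono) auto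
        finally show "dist (p i) (p j) \<le> C * \<bar>F i - F j\<bar>" .
      qed
      have "\<bar>F i - F j\<bar> \<le> dist (p i) (p j) \<and> dist (p i) (p j) \<le> C * \<bar>F i - F j\<bar>"
        if "i \<in> good'" "j \<in> good'" for i j
        using *[of i j] *[of j i] that by (cases "i \<le> j") (auto simp: dist_commute abs_minus_commute)
      then show ?thesis by (auto simp: bilip_pairs_def P_def)
    qed
    moreover have "P \<subseteq> {-R..R} \<times> A"
    proof -
      have "p i \<in> A" if "i \<in> good'" for i
        using that by (intro p) (simp add: good'_def good_def)
      then have "(F i, p i) \<in> {-R..R} \<times> A" if "i \<in> good'" for i
        using R[of "p i"] that by (simp add: F_def abs_le_iff)
      then show ?thesis unfolding P_def by blast
    qed
    ultimately have less: "measure lebesgue (\<Union>v\<in>fst ` P. {v..v + \<delta>}) < \<eta> / 2"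
      using fin' by (intro small) (auto simp: P_def)
    \<comment> \<open>Off \<open>good'\<close> the step is longer than \<open>\<delta>\<close>, so
      its cost is at least the increment of \<open>f\<close>.\<close>
    have w_cost: "w i \<le> cost i" if "i \<in> good" "i \<notin> good'" for i
      using w(2)[OF that(1)] that by (auto simp: good'_def cost_def step_cost_def F_def)
    have split: "(\<Sum>i\<in>good. w i) = (\<Sum>i\<in>good - good'. w i) + (\<Sum>i\<in>good'. w i)"
      using fin by (intro sum.subset_diff) (auto simp: good'_def)
    have "(\<Sum>i\<in>good - good'. w i) \<le> (\<Sum>i\<in>good - good'. cost i)"
      using w_cost by (intro sum_mono) auto
    also have "\<dots> \<le> (\<Sum>i<N. cost i)"
      using cost_nonneg by (intro sum_mono2) (auto simp: good_def)
    finally have large_steps: "(\<Sum>i\<in>good - good'. w i) \<le> (\<Sum>i<N. cost i)" .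
    have "(\<Sum>i\<in>good'. w i) = (\<Sum>i\<in>good'. measure lebesgue {F i..<F i + w i})"
      using w(1) by (intro sum.cong) auto
    also have "\<dots> = measure lebesgue (\<Union>i\<in>good'. {F i..<F i + w i})"
      by (rule measure_UNION'[symmetric, OF fin'])
        (use w(3) in \<open>auto simp: good'_def intro: pairwise_subset bounded_set_imp_lmeasurable\<close>)
    also have "\<dots> \<le> measure lebesgue (\<Union>v\<in>fst ` P. {v..v + \<delta>})"
    proof (rule measure_mono_fmeasurable)
      have "w i \<le> \<delta>" if "i \<in> good'" for i
      proof -
        have i: "i \<in> good" "Suc i \<le> N" "dist (p i) (p (Suc i)) \<le> \<delta>"
          using that by (auto simp: good'_def good_def)
        then show ?thesis
          using w(2)[OF i(1)] f[of "p (Suc i)" "p i"] p[of i] p[of "Suc i"]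
          by (simp add: F_def dist_commute)
      qed
      then have "{F i..<F i + w i} \<subseteq> {F i..F i + \<delta>}" if "i \<in> good'" for i
        using that by force
      then have "(\<Union>i\<in>good'. {F i..<F i + w i}) \<subseteq> (\<Union>i\<in>good'. {F i..F i + \<delta>})"
        by blast
      then show "(\<Union>i\<in>good'. {F i..<F i + w i}) \<subseteq> (\<Union>v\<in>fst ` P. {v..v + \<delta>})"
        by (simp add: P_def image_image)
    qed (use fin' in \<open>auto simp: P_def\<close>)
    finally have "(\<Sum>i\<in>good'. w i) < \<eta> / 2" using less by simp
    moreover have "s 0 / C = 0" by (simp add: s_def)
    ultimately show False
      using split large_steps w(4) sN big by linarith
  qed
  with \<delta> show ?thesis by blast
qed


text \<open>\<open>h\<close> is the infimal convolution of \<open>f\<close> with the chain distance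
  generated by \<open>step_cost\<close>. The trivial chain gives \<open>h \<le> f\<close>,
  \<open>chain_bound\<close> gives the lower bound, and appending one step to a chain gives both
  difference estimates.\<close>

lemma flatten_step:
  fixes A :: "'a::metric_space set"
  assumes A: "compact A" "purely_1_unrectifiable A"
    and f: "\<And>x y. x \<in> A \<Longrightarrow> y \<in> A \<Longrightarrow> \<bar>f x - f y\<bar> \<le> dist x y"
    and \<epsilon>: "0 < \<epsilon>" and \<eta>: "0 < \<eta>"
  obtains \<delta> h where "0 < \<delta>" "\<And>x. x \<in> A \<Longrightarrow> f x - \<eta> \<le> h x" "\<And>x. x \<in> A \<Longrightarrow> h x \<le> f x"
    "\<And>x y. x \<in> A \<Longrightarrow> y \<in> A \<Longrightarrow> \<bar>h x - h y\<bar> \<le> max \<bar>f x - f y\<bar> (\<epsilon> * dist x y)"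
    "\<And>x y. x \<in> A \<Longrightarrow> y \<in> A \<Longrightarrow> dist x y \<le> \<delta> \<Longrightarrow> \<bar>h x - h y\<bar> \<le> \<epsilon> * dist x y"
proof -
  obtain \<delta> where \<delta>: "0 < \<delta>" and chain: "\<And>p N. \<forall>i\<le>N. p i \<in> A \<Longrightarrow>
      f (p N) - f (p 0) \<le> \<eta> + (\<Sum>i<N. step_cost f \<epsilon> \<delta> (p i) (p (Suc i)))"
    using chain_bound[OF A f \<epsilon> \<eta>] by blast
  define S where "S x = {f (p 0) + (\<Sum>i<N. step_cost f \<epsilon> \<delta> (p i) (p (Suc i))) | p N.
      (\<forall>i\<le>N. p i \<in> A) \<and> p N = x}" for x
  define h where "h x = Inf (S x)" for x
  have S_ge: "f x - \<eta> \<le> t" if "t \<in> S x" for t x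
  proof -
    obtain p N where p: "\<forall>i\<le>N. p i \<in> A" "p N = x"
        "t = f (p 0) + (\<Sum>i<N. step_cost f \<epsilon> \<delta> (p i) (p (Suc i)))"
      using \<open>t \<in> S x\<close> by (auto simp: S_def)
    with chain[OF p(1)] show ?thesis by simp
  qed
  have f_in_S: "f x \<in> S x" if "x \<in> A" for x
    unfolding S_def using that by (intro CollectI exI[of _ "\<lambda>_. x"] exI[of _ 0]) auto
  have bdd: "bdd_below (S x)" for x
    using S_ge by (rule bdd_belowI)
  have S_step: "t + step_cost f \<epsilon> \<delta> x y \<in> S y" if "t \<in> S x" "y \<in> A" for t x y
  proof -
    obtain p N where p: "\<forall>i\<le>N. p i \<in> A" "p N = x"
        "t = f (p 0) + (\<Sum>i<N. step_cost f \<epsilon> \<delta> (p i) (p (Suc i)))"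
      using \<open>t \<in> S x\<close> by (auto simp: S_def)
    define q where "q i = (if i \<le> N then p i else y)" for i
    have "(\<Sum>i<Suc N. step_cost f \<epsilon> \<delta> (q i) (q (Suc i))) =
        (\<Sum>i<N. step_cost f \<epsilon> \<delta> (p i) (p (Suc i))) + step_cost f \<epsilon> \<delta> x y"
      using p(2) by (simp add: q_def)
    then show ?thesis
      unfolding S_def using p \<open>y \<in> A\<close>
      by (intro CollectI exI[of _ q] exI[of _ "Suc N"]) (auto simp: q_def)
  qed
  have h_le: "h y \<le> h x + step_cost f \<epsilon> \<delta> x y" if "x \<in> A" "y \<in> A" for x y
  proof -
    have "h y - step_cost f \<epsilon> \<delta> x y \<le> t" if "t \<in> S x" for t
      using cInf_lower[OF S_step[OF that \<open>y \<in> A\<close>] bdd] by (simp add: h_def)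
    then have "h y - step_cost f \<epsilon> \<delta> x y \<le> h x"
      unfolding h_def[of x] using f_in_S[OF \<open>x \<in> A\<close>] by (intro cInf_greatest) auto
    then show ?thesis by simp
  qed
  have h_diff: "\<bar>h x - h y\<bar> \<le> step_cost f \<epsilon> \<delta> x y" if "x \<in> A" "y \<in> A" for x y
    using h_le[OF that] h_le[OF that(2,1)] by (simp add: step_cost_commute[of f \<epsilon> \<delta> y x] abs_le_iff)
  show thesis
  proof (rule that[OF \<delta>])
    show "f x - \<eta> \<le> h x" if "x \<in> A" for x
      unfolding h_def using S_ge f_in_S[OF that] by (intro cInf_greatest) auto
    show "h x \<le> f x" if "x \<in> A" for x
      unfolding h_def by (rule cInf_lower[OF f_in_S[OF that] bdd])
    show "\<bar>h x - h y\<bar> \<le> max \<bar>f x - f y\<bar> (\<epsilon> * dist x y)" if "x \<in> A" "y \<in> A" for x y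
      using h_diff[OF that] step_cost_le by (rule order_trans)
    show "\<bar>h x - h y\<bar> \<le> \<epsilon> * dist x y" if "x \<in> A" "y \<in> A" "dist x y \<le> \<delta>" for x y
      using h_diff[OF that(1,2)] that(3) by (simp add: step_cost_def)
  qed
qed

text \<open>A condition on a two-point function, so that it covers
  \<open>\<bar>g x - g y\<bar>\<close> and finite sums of such terms alike. The scale
  \<open>\<delta>\<close> is uniform over \<open>A\<close>.\<close>

definition little_lipschitz_on :: "'a::metric_space set \<Rightarrow> ('a \<Rightarrow> 'a \<Rightarrow> real) \<Rightarrow> bool" where
  "little_lipschitz_on A S \<longleftrightarrow>
    (\<forall>\<epsilon>>0. \<exists>\<delta>>0. \<forall>x\<in>A. \<forall>y\<in>A. dist x y \<le> \<delta> \<longrightarrow> S x y \<le> \<epsilon> * dist x y)"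

lemma little_lipschitz_on_add:
  assumes "little_lipschitz_on A S" "little_lipschitz_on A T"
  shows "little_lipschitz_on A (\<lambda>x y. S x y + T x y)"
  unfolding little_lipschitz_on_def
proof (intro allI impI)
  fix \<epsilon> :: real assume "0 < \<epsilon>"
  then have "0 < \<epsilon> / 2" by simp
  obtain d where "0 < d" and d: "\<forall>x\<in>A. \<forall>y\<in>A. dist x y \<le> d \<longrightarrow> S x y \<le> \<epsilon> / 2 * dist x y"
    using assms(1) \<open>0 < \<epsilon> / 2\<close> unfolding little_lipschitz_on_def by meson
  obtain e where "0 < e" and e: "\<forall>x\<in>A. \<forall>y\<in>A. dist x y \<le> e \<longrightarrow> T x y \<le> \<epsilon> / 2 * dist x y"
    using assms(2) \<open>0 < \<epsilon> / 2\<close> unfolding little_lipschitz_on_def by meson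
  have "S x y + T x y \<le> \<epsilon> * dist x y" if "x \<in> A" "y \<in> A" "dist x y \<le> min d e" for x y
  proof -
    have "S x y \<le> \<epsilon> / 2 * dist x y" "T x y \<le> \<epsilon> / 2 * dist x y"
      using d e that by auto
    then show ?thesis by simp
  qed
  with \<open>0 < d\<close> \<open>0 < e\<close>
  show "\<exists>\<delta>>0. \<forall>x\<in>A. \<forall>y\<in>A. dist x y \<le> \<delta> \<longrightarrow> S x y + T x y \<le> \<epsilon> * dist x y"
    by (intro exI[of _ "min d e"]) auto
qed

text \<open>Iteration of \<open>flatten_step\<close> with slopes \<open>1 / 2 ^ n\<close> and errors
  \<open>\<eta> / 2 ^ Suc n\<close>. The functions decrease and stay above
  \<open>f - \<eta>\<close>, hence converge. A slope reached at one stage survives the later ones,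
  whose own slopes are smaller.\<close>

lemma flatten:
  fixes A :: "'a::metric_space set"
  assumes A: "compact A" "purely_1_unrectifiable A"
    and f: "\<And>x y. x \<in> A \<Longrightarrow> y \<in> A \<Longrightarrow> \<bar>f x - f y\<bar> \<le> dist x y"
    and \<eta>: "0 < \<eta>"
  obtains h where "\<And>x. x \<in> A \<Longrightarrow> \<bar>h x - f x\<bar> \<le> \<eta>"
    "\<And>x y. x \<in> A \<Longrightarrow> y \<in> A \<Longrightarrow> \<bar>h x - h y\<bar> \<le> dist x y"
    "little_lipschitz_on A (\<lambda>x y. \<bar>h x - h y\<bar>)"
proof -
  \<comment> \<open>A state is a function with the scale at which it is flat; the clause for
    \<open>n = 0\<close> starts the recursion at \<open>f\<close>.\<close>
  define P where "P n z \<longleftrightarrow> (\<forall>x\<in>A. \<forall>y\<in>A. \<bar>fst z x - fst z y\<bar> \<le> dist x y) \<and> (n = 0 \<longrightarrow> fst z = f)"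
    for n :: nat and z :: "('a \<Rightarrow> real) \<times> real"
  define Q where "Q n z z' \<longleftrightarrow> 0 < snd z' \<and>
      (\<forall>x\<in>A. fst z x - \<eta> / 2 ^ Suc n \<le> fst z' x \<and> fst z' x \<le> fst z x) \<and>
      (\<forall>x\<in>A. \<forall>y\<in>A. \<bar>fst z' x - fst z' y\<bar> \<le> max \<bar>fst z x - fst z y\<bar> (dist x y / 2 ^ n)) \<and>
      (\<forall>x\<in>A. \<forall>y\<in>A. dist x y \<le> snd z' \<longrightarrow> \<bar>fst z' x - fst z' y\<bar> \<le> dist x y / 2 ^ n)"
    for n :: nat and z z' :: "('a \<Rightarrow> real) \<times> real"
  have "\<exists>z. P 0 z" by (rule exI[of _ "(f, 1)"]) (auto simp: P_def f)
  moreover have "\<exists>z'. P (Suc n) z' \<and> Q n z z'" if Pz: "P n z" for n z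
  proof -
    have lip: "\<And>x y. x \<in> A \<Longrightarrow> y \<in> A \<Longrightarrow> \<bar>fst z x - fst z y\<bar> \<le> dist x y"
      using Pz by (simp add: P_def)
    have pos: "0 < (1 / 2 ^ n :: real)" "0 < \<eta> / 2 ^ Suc n"
      using \<eta> by auto
    obtain \<delta> h where h: "0 < \<delta>" "\<And>x. x \<in> A \<Longrightarrow> fst z x - \<eta> / 2 ^ Suc n \<le> h x" "\<And>x. x \<in> A \<Longrightarrow> h x \<le> fst z x"
      "\<And>x y. x \<in> A \<Longrightarrow> y \<in> A \<Longrightarrow> \<bar>h x - h y\<bar> \<le> max \<bar>fst z x - fst z y\<bar> (1 / 2 ^ n * dist x y)"
      "\<And>x y. x \<in> A \<Longrightarrow> y \<in> A \<Longrightarrow> dist x y \<le> \<delta> \<Longrightarrow> \<bar>h x - h y\<bar> \<le> 1 / 2 ^ n * dist x y"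
      by (rule flatten_step[OF A lip pos]) (assumption | rule that)+
    have "\<bar>h x - h y\<bar> \<le> dist x y" if "x \<in> A" "y \<in> A" for x y
    proof -
      have "1 / 2 ^ n * dist x y \<le> 1 * dist x y"
        by (intro mult_right_mono) auto
      with h(4)[OF that] lip[OF that] show ?thesis
        by linarith
    qed
    with h show ?thesis
      by (intro exI[of _ "(h, \<delta>)"]) (auto simp: P_def Q_def)
  qed
  ultimately obtain Z where PZ: "\<And>n. P n (Z n)" and QZ: "\<And>n. Q n (Z n) (Z (Suc n))"
    using dependent_nat_choice[of P Q] by metis
  define g where "g n = fst (Z n)" for n
  have g0: "g 0 = f" using PZ[of 0] by (simp add: P_def g_def)
  have g_lip: "\<bar>g n x - g n y\<bar> \<le> dist x y" if "x \<in> A" "y \<in> A" for n x y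
    using PZ[of n] that by (simp add: P_def g_def)
  have g_step: "g n x - \<eta> / 2 ^ Suc n \<le> g (Suc n) x" "g (Suc n) x \<le> g n x" if "x \<in> A" for n x
    using QZ[of n] that by (simp_all add: Q_def g_def)
  have g_low: "f x - \<eta> * (1 - 1 / 2 ^ n) \<le> g n x" if "x \<in> A" for n x
  proof (induction n)
    case (Suc n)
    then show ?case using g_step(1)[OF that, of n] by (simp add: field_simps)
  qed (simp add: g0)
  have g_low': "f x - \<eta> \<le> g n x" if "x \<in> A" for n x
  proof -
    have "\<eta> * (1 - 1 / 2 ^ n) \<le> \<eta> * 1" using \<eta> by (intro mult_left_mono) auto
    with g_low[OF that, of n] show ?thesis by simp
  qed
  have g_up: "g n x \<le> f x" if "x \<in> A" for n x
  proof (induction n)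
    case (Suc n)
    then show ?case using g_step(2)[OF that, of n] by simp
  qed (simp add: g0)
  define h where "h x = lim (\<lambda>n. g n x)" for x
  have lim: "(\<lambda>n. g n x) \<longlonglongrightarrow> h x" if "x \<in> A" for x
  proof -
    have "decseq (\<lambda>n. g n x)" using g_step(2)[OF that] by (rule decseq_SucI)
    then have "convergent (\<lambda>n. g n x)"
      using decseq_convergent[of "\<lambda>n. g n x" "f x - \<eta>"] g_low'[OF that] by (metis convergentI)
    then show ?thesis by (simp add: h_def convergent_LIMSEQ_iff)
  qed
  have lim_diff: "(\<lambda>n. \<bar>g n x - g n y\<bar>) \<longlonglongrightarrow> \<bar>h x - h y\<bar>" if "x \<in> A" "y \<in> A" for x y
    using lim that by (intro tendsto_intros) auto
  show thesis
  proof
    fix x assume x: "x \<in> A"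
    have "f x - \<eta> \<le> h x" using LIMSEQ_le_const[OF lim[OF x]] g_low'[OF x] by blast
    moreover have "h x \<le> f x" using LIMSEQ_le_const2[OF lim[OF x]] g_up[OF x] by blast
    ultimately show "\<bar>h x - f x\<bar> \<le> \<eta>" using \<eta> by simp
  next
    fix x y assume "x \<in> A" "y \<in> A"
    then show "\<bar>h x - h y\<bar> \<le> dist x y"
      using LIMSEQ_le_const2[OF lim_diff] g_lip by blast
  next
    show "little_lipschitz_on A (\<lambda>x y. \<bar>h x - h y\<bar>)"
      unfolding little_lipschitz_on_def
    proof (intro allI impI)
      fix \<epsilon> :: real assume "0 < \<epsilon>"
      then obtain n where n: "(1/2) ^ n < \<epsilon>" using real_arch_pow_inv[of \<epsilon> "1/2"] by auto
      \<comment> \<open>The scale belongs to stage \<open>n\<close> and does not depend on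
        \<open>k\<close>, so the bound passes to the limit.\<close>
      have flat: "\<bar>g (Suc n + k) x - g (Suc n + k) y\<bar> \<le> dist x y / 2 ^ n"
        if "x \<in> A" "y \<in> A" "dist x y \<le> snd (Z (Suc n))" for x y k
      proof (induction k)
        case 0
        then show ?case using QZ[of n] that by (simp add: Q_def g_def)
      next
        case (Suc k)
        have "\<bar>g (Suc n + Suc k) x - g (Suc n + Suc k) y\<bar>
            \<le> max \<bar>g (Suc n + k) x - g (Suc n + k) y\<bar> (dist x y / 2 ^ (Suc n + k))"
          using QZ[of "Suc n + k"] that by (simp add: Q_def g_def)
        moreover have "dist x y / 2 ^ (Suc n + k) \<le> dist x y / 2 ^ n"
          by (intro divide_left_mono power_increasing) auto
        ultimately show ?case using Suc.IH by linarith
      qed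
      have "\<bar>h x - h y\<bar> \<le> \<epsilon> * dist x y"
        if "x \<in> A" "y \<in> A" "dist x y \<le> snd (Z (Suc n))" for x y
      proof -
        have "\<bar>h x - h y\<bar> \<le> dist x y / 2 ^ n"
          using LIMSEQ_le_const2[OF LIMSEQ_ignore_initial_segment[OF lim_diff[OF that(1,2)], of "Suc n"]]
            flat[OF that] by (auto simp: add.commute)
        also have "\<dots> = (1/2) ^ n * dist x y" by (simp add: power_divide)
        also have "\<dots> \<le> \<epsilon> * dist x y" using n by (intro mult_right_mono) auto
        finally show ?thesis .
      qed
      moreover have "0 < snd (Z (Suc n))" using QZ[of n] by (simp add: Q_def)
      ultimately show "\<exists>\<delta>>0. \<forall>x\<in>A. \<forall>y\<in>A. dist x y \<le> \<delta> \<longrightarrow> \<bar>h x - h y\<bar> \<le> \<epsilon> * dist x y"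
        by blast
    qed
  qed
qed

section \<open>Lipschitz functions and (V*)-sets\<close>

lemma lip0_diff_le: "\<bar>lip0_apply f x - lip0_apply f y\<bar> \<le> norm f * dist x y"
  using lipschitz_onD[OF norm_lip0_lipschitz[of f], of x y] by (simp add: dist_real_def)

lemma lip0_apply_Lip0:
  assumes "f base_point = 0" "0 \<le> C" "\<And>x y. \<bar>f x - f y\<bar> \<le> C * dist x y"
  shows "lip0_apply (Lip0 f) = f" "norm (Lip0 f) \<le> C"
proof -
  have lip: "C-lipschitz_on UNIV f"
    using assms by (auto simp: lipschitz_on_def dist_real_def)
  then show eq: "lip0_apply (Lip0 f) = f"
    using assms(1) by (intro Lip0_inverse) auto
  show "norm (Lip0 f) \<le> C"
    using lip by (intro norm_lip0_le) (simp add: eq)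
qed

lemma lip0_apply_sum: "lip0_apply (\<Sum>k\<in>K. f k) x = (\<Sum>k\<in>K. lip0_apply (f k) x)"
  by (induction K rule: infinite_finite_induct) (auto simp: plus_lip0.rep_eq zero_lip0.rep_eq)

lemma blinfun_norm_witness:
  fixes \<gamma> :: "'x::real_normed_vector \<Rightarrow>\<^sub>L real"
  assumes "0 \<le> c" "c < norm \<gamma>"
  obtains f where "norm f \<le> 1" "c < \<gamma> f"
proof -
  obtain f where f: "c * norm f < \<bar>\<gamma> f\<bar>"
    using norm_blinfun_bound[OF assms(1), of \<gamma>] assms(2) by (metis not_le real_norm_def)
  then have "f \<noteq> 0" by auto
  show thesis
  proof (rule that[of "(sgn (\<gamma> f) / norm f) *\<^sub>R f"])
    show "norm ((sgn (\<gamma> f) / norm f) *\<^sub>R f) \<le> 1"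
      using \<open>f \<noteq> 0\<close> by (simp add: abs_sgn_eq)
    have "\<gamma> ((sgn (\<gamma> f) / norm f) *\<^sub>R f) = \<bar>\<gamma> f\<bar> / norm f"
      by (simp add: blinfun.scaleR_right abs_sgn mult.commute)
    with f \<open>f \<noteq> 0\<close> show "c < \<gamma> ((sgn (\<gamma> f) / norm f) *\<^sub>R f)"
      by (simp add: pos_less_divide_eq)
  qed
qed

text \<open>\<open>u\<close> is within \<open>\<kappa>\<close> of a finite combination of
  evaluations: \<open>E\<close> is the set of its points and \<open>C\<close> the sum of the
  absolute values of its coefficients.\<close>

lemma free_finite_support:
  assumes "0 < \<kappa>"
  obtains E C where "finite E" "0 \<le> C"
    "\<And>h s. 0 \<le> s \<Longrightarrow> (\<And>e. e \<in> E \<Longrightarrow> \<bar>lip0_apply h e\<bar> \<le> s) \<Longrightarrow>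
      \<bar>free_to_dual u h\<bar> \<le> \<kappa> * norm h + C * s"
proof -
  obtain m where m: "m \<in> span (range lip0_delta)" "dist m (free_to_dual u) < \<kappa>"
    using free_to_dual[of u] assms by (meson closure_approachable)
  obtain t r where t: "finite t" "t \<subseteq> range lip0_delta" "m = (\<Sum>a\<in>t. r a *\<^sub>R a)"
    using m(1) by (auto simp: span_explicit)
  obtain E where E: "finite E" "t = lip0_delta ` E"
    using finite_subset_image[OF t(1,2)] by blast
  show thesis
  proof (rule that[of E "\<Sum>a\<in>t. \<bar>r a\<bar>"])
    fix h :: "'a lip0" and s :: real
    assume s: "0 \<le> s" "\<And>e. e \<in> E \<Longrightarrow> \<bar>lip0_apply h e\<bar> \<le> s"
    have "\<bar>m h\<bar> = \<bar>\<Sum>a\<in>t. r a * a h\<bar>"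
      by (simp add: t(3) blinfun.sum_left blinfun.scaleR_left)
    also have "\<dots> \<le> (\<Sum>a\<in>t. \<bar>r a\<bar> * s)"
    proof (rule order_trans[OF sum_abs sum_mono])
      fix a assume "a \<in> t"
      then obtain e where "e \<in> E" "a = lip0_delta e" using E(2) by auto
      then have "\<bar>a h\<bar> \<le> s" using s(2)[of e] by (simp add: lip0_delta.rep_eq)
      then show "\<bar>r a * a h\<bar> \<le> \<bar>r a\<bar> * s"
        by (simp add: abs_mult mult_left_mono)
    qed
    finally have mh: "\<bar>m h\<bar> \<le> (\<Sum>a\<in>t. \<bar>r a\<bar>) * s"
      by (simp add: sum_distrib_right)
    have "\<bar>free_to_dual u h - m h\<bar> \<le> norm (free_to_dual u - m) * norm h"
      using norm_blinfun[of "free_to_dual u - m" h] by (simp add: blinfun.diff_left)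
    also have "\<dots> \<le> \<kappa> * norm h"
      using m(2) by (intro mult_right_mono) (auto simp: dist_norm norm_minus_commute)
    finally show "\<bar>free_to_dual u h\<bar> \<le> \<kappa> * norm h + (\<Sum>a\<in>t. \<bar>r a\<bar>) * s"
      using mh by linarith
  qed (auto simp: E(1) intro: sum_nonneg)
qed

text \<open>For \<open>0 \<le> C\<close> this says that all signed partial sums are
  \<open>C\<close>-Lipschitz, which is the working criterion for WUC series.\<close>

definition sum_lipschitz :: "real \<Rightarrow> (nat \<Rightarrow> 'a::metric_space \<Rightarrow> real) \<Rightarrow> bool" where
  "sum_lipschitz C g \<longleftrightarrow> (\<forall>n x y. (\<Sum>k<n. \<bar>g k x - g k y\<bar>) \<le> C * dist x y)"

section \<open>Weakly unconditionally Cauchy series in the dual of the free space\<close>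

lemma bounded_linear_lip0_eval: "bounded_linear (\<lambda>u. free_to_dual u f)"
proof (rule bounded_linear_intro)
  show "norm (free_to_dual u f) \<le> norm u * norm f" for u
    using norm_blinfun[of "free_to_dual u" f] by (simp add: norm_lipschitz_free.rep_eq)
qed (simp_all add: plus_lipschitz_free.rep_eq scaleR_lipschitz_free.rep_eq
      blinfun.add_left blinfun.scaleR_left)

lift_definition lip0_eval :: "'a::pointed_metric_space lip0 \<Rightarrow> 'a lipschitz_free \<Rightarrow>\<^sub>L real" is
  "\<lambda>f u. free_to_dual u f"
  by (rule bounded_linear_lip0_eval)

lemma norm_lip0_eval_le: "norm (lip0_eval f) \<le> norm f"
proof (rule norm_blinfun_bound)
  show "norm (lip0_eval f u) \<le> norm f * norm u" for u
    using norm_blinfun[of "free_to_dual u" f]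
    by (simp add: norm_lipschitz_free.rep_eq lip0_eval.rep_eq mult.commute)
qed simp

lemma lip0_eval_sum_scaleR:
  "(\<Sum>k\<in>K. c k *\<^sub>R lip0_eval (f k)) = lip0_eval (\<Sum>k\<in>K. c k *\<^sub>R f k)"
  by (rule blinfun_eqI)
    (simp add: blinfun.sum_left blinfun.scaleR_left lip0_eval.rep_eq blinfun.sum_right blinfun.scaleR_right)

text \<open>Signs \<open>c k\<close> turn the partial sum of absolute values into the value of
  \<open>\<psi>\<close> at a single function \<open>F\<close>, a signed partial sum of norm at most
  \<open>C\<close>.\<close>

lemma weakly_unconditionally_Cauchy_lip0_eval:
  assumes "0 \<le> C" "sum_lipschitz C (\<lambda>k. lip0_apply (f k))"
  shows "weakly_unconditionally_Cauchy (\<lambda>k. lip0_eval (f k))"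
  unfolding weakly_unconditionally_Cauchy_def
proof
  fix \<psi> :: "('a lipschitz_free \<Rightarrow>\<^sub>L real) \<Rightarrow>\<^sub>L real"
  have "(\<Sum>k<n. \<bar>\<psi> (lip0_eval (f k))\<bar>) \<le> norm \<psi> * C" for n
  proof -
    define c where "c k = sgn (\<psi> (lip0_eval (f k)))" for k
    define F where "F = (\<Sum>k<n. c k *\<^sub>R f k)"
    have F_apply: "lip0_apply F x = (\<Sum>k<n. c k * lip0_apply (f k) x)" for x
      by (simp add: F_def lip0_apply_sum scaleR_lip0.rep_eq)
    have F_lip: "\<bar>lip0_apply F x - lip0_apply F y\<bar> \<le> C * dist x y" for x y
    proof -
      have "\<bar>lip0_apply F x - lip0_apply F y\<bar> = \<bar>\<Sum>k<n. c k * (lip0_apply (f k) x - lip0_apply (f k) y)\<bar>"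
        by (simp add: F_apply sum_subtractf right_diff_distrib)
      also have "\<dots> \<le> (\<Sum>k<n. \<bar>lip0_apply (f k) x - lip0_apply (f k) y\<bar>)"
        by (rule order_trans[OF sum_abs sum_mono]) (auto simp: abs_mult c_def abs_sgn_eq)
      also have "\<dots> \<le> C * dist x y"
        using assms(2) by (simp add: sum_lipschitz_def)
      finally show ?thesis .
    qed
    have "norm F \<le> C"
      by (intro norm_lip0_le) (auto simp: lipschitz_on_def dist_real_def assms(1) F_lip)
    have "(\<Sum>k<n. \<bar>\<psi> (lip0_eval (f k))\<bar>) = \<psi> (\<Sum>k<n. c k *\<^sub>R lip0_eval (f k))"
      by (simp add: blinfun.sum_right blinfun.scaleR_right c_def abs_sgn mult.commute)
    also have "\<dots> = \<psi> (lip0_eval F)"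
      by (simp only: lip0_eval_sum_scaleR F_def)
    also have "\<dots> \<le> norm \<psi> * norm (lip0_eval F)"
      using norm_blinfun[of \<psi> "lip0_eval F"] by simp
    also have "\<dots> \<le> norm \<psi> * C"
      using norm_lip0_eval_le[of F] \<open>norm F \<le> C\<close> by (intro mult_left_mono) auto
    finally show ?thesis .
  qed
  then show "summable (\<lambda>k. \<bar>\<psi> (lip0_eval (f k))\<bar>)"
    by (intro summableI_nonneg_bounded) auto
qed

text \<open>The form in which the hypothesis on \<open>\<Gamma>\<close> enters all gliding hump
  arguments: each builds a series with \<open>sum_lipschitz\<close> on which \<open>\<Gamma>\<close>
  stays large.\<close>

lemma V_star_set_sum_lipschitz:
  assumes "V_star_set \<Gamma>" "0 \<le> C" "sum_lipschitz C (\<lambda>k. lip0_apply (f k))" "0 < c"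
  shows "\<exists>N. \<forall>n\<ge>N. \<forall>u\<in>\<Gamma>. \<bar>free_to_dual u (f n)\<bar> < c"
proof -
  have "(\<lambda>n. SUP u\<in>\<Gamma>. ennreal \<bar>lip0_eval (f n) u\<bar>) \<longlonglongrightarrow> 0"
    using assms(1) weakly_unconditionally_Cauchy_lip0_eval[OF assms(2,3)]
    unfolding V_star_set_def by blast
  then have "\<forall>\<^sub>F n in sequentially. (SUP u\<in>\<Gamma>. ennreal \<bar>lip0_eval (f n) u\<bar>) < ennreal c"
    using assms(4) by (intro order_tendstoD) auto
  then obtain N where N: "\<And>n. n \<ge> N \<Longrightarrow> (SUP u\<in>\<Gamma>. ennreal \<bar>lip0_eval (f n) u\<bar>) < ennreal c"
    by (auto simp: eventually_sequentially)
  have "\<bar>free_to_dual u (f n)\<bar> < c" if "n \<ge> N" "u \<in> \<Gamma>" for n u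
  proof -
    have "ennreal \<bar>lip0_eval (f n) u\<bar> < ennreal c"
      using SUP_upper[OF that(2), of "\<lambda>u. ennreal \<bar>lip0_eval (f n) u\<bar>"] N[OF that(1)]
      by (rule le_less_trans)
    then show ?thesis
      using assms(4) by (simp add: ennreal_less_iff lip0_eval.rep_eq)
  qed
  then show ?thesis by blast
qed

text \<open>An unbounded \<open>\<Gamma>\<close> yields \<open>f n\<close> of norm at most
  \<open>1 / 2 ^ n\<close>, hence an absolutely convergent series, on each of which some element of
  \<open>\<Gamma>\<close> is at least 1 in absolute value.\<close>

lemma V_star_set_bounded:
  fixes \<Gamma> :: "'a::pointed_metric_space lipschitz_free set"
  assumes "V_star_set \<Gamma>"
  obtains R where "0 \<le> R" "\<And>u. u \<in> \<Gamma> \<Longrightarrow> norm u \<le> R"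
proof -
  have "\<exists>R. \<forall>u\<in>\<Gamma>. norm u \<le> R"
  proof (rule ccontr)
    assume neg: "\<not> ?thesis"
    have "\<exists>u f. u \<in> \<Gamma> \<and> norm f \<le> 1 / 2 ^ n \<and> 1 \<le> \<bar>free_to_dual u f\<bar>" for n :: nat
    proof -
      obtain u where u: "u \<in> \<Gamma>" "2 ^ n < norm u"
        using neg by (auto simp: not_le)
      have "0 \<le> (2::real) ^ n" "2 ^ n < norm (free_to_dual u)"
        using u(2) by (simp_all add: norm_lipschitz_free.rep_eq)
      then obtain f where f: "norm f \<le> 1" "2 ^ n < free_to_dual u f"
        by (rule blinfun_norm_witness)
      have "norm ((1 / 2 ^ n) *\<^sub>R f) \<le> 1 / 2 ^ n"
        using f(1) by (simp add: divide_right_mono)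
      moreover have "1 \<le> \<bar>free_to_dual u ((1 / 2 ^ n) *\<^sub>R f)\<bar>"
        using f(2) by (simp add: blinfun.scaleR_right)
      ultimately show ?thesis using u(1) by blast
    qed
    then obtain u f where uf: "\<And>n. u n \<in> \<Gamma>" "\<And>n. norm (f n) \<le> 1 / 2 ^ n"
        "\<And>n. 1 \<le> \<bar>free_to_dual (u n) (f n)\<bar>"
      by metis
    have "sum_lipschitz 2 (\<lambda>k. lip0_apply (f k))"
      unfolding sum_lipschitz_def
    proof (intro allI)
      fix n x y
      have "(\<Sum>k<n. \<bar>lip0_apply (f k) x - lip0_apply (f k) y\<bar>) \<le> (\<Sum>k<n. (1/2) ^ k * dist x y)"
      proof (rule sum_mono)
        fix k
        show "\<bar>lip0_apply (f k) x - lip0_apply (f k) y\<bar> \<le> (1/2) ^ k * dist x y"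
          using lip0_diff_le[of "f k" x y] mult_right_mono[OF uf(2)[of k], of "dist x y"]
          by (simp add: power_divide)
      qed
      also have "\<dots> = (2 - 2 * (1/2) ^ n) * dist x y"
        by (simp add: sum_distrib_right[symmetric] sum_gp_strict)
      also have "\<dots> \<le> 2 * dist x y"
        by (intro mult_right_mono) auto
      finally show "(\<Sum>k<n. \<bar>lip0_apply (f k) x - lip0_apply (f k) y\<bar>) \<le> 2 * dist x y" .
    qed
    then obtain N where "\<forall>n\<ge>N. \<forall>v\<in>\<Gamma>. \<bar>free_to_dual v (f n)\<bar> < 1"
      using V_star_set_sum_lipschitz[OF assms, of 2 f 1] by auto
    with uf(1,3)[of N] show False by force
  qed
  then obtain R where "\<forall>u\<in>\<Gamma>. norm u \<le> R" ..
  then show thesis by (intro that[of "max R 0"]) force+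
qed

section \<open>Tightness of (V*)-sets\<close>

text \<open>
  The factor \<open>dist x base_point\<close> makes multiplication by \<open>\<theta>\<close> bounded on the Lipschitz functions vanishing at
  the base point even when \<open>M\<close> is unbounded.
\<close>

definition lip_multiplier :: "real \<Rightarrow> ('a::pointed_metric_space \<Rightarrow> real) \<Rightarrow> bool" where
  "lip_multiplier B \<theta> \<longleftrightarrow> 0 \<le> B \<and> (\<forall>x. 0 \<le> \<theta> x \<and> \<theta> x \<le> 1) \<and>
    (\<forall>x y. \<bar>\<theta> x - \<theta> y\<bar> * dist x base_point \<le> B * dist x y)"

lemma lip_multiplier_one: "lip_multiplier 0 (\<lambda>_. 1)"
  by (simp add: lip_multiplier_def)

lemma lip_multiplier_complement:
  assumes "lip_multiplier B \<theta>" shows "lip_multiplier B (\<lambda>x. 1 - \<theta> x)"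
  using assms by (auto simp: lip_multiplier_def abs_minus_commute)

lemma lip_multiplier_mult:
  assumes "lip_multiplier B \<theta>" "lip_multiplier B' \<theta>'"
  shows "lip_multiplier (B + B') (\<lambda>x. \<theta> x * \<theta>' x)"
  unfolding lip_multiplier_def
proof (intro conjI allI)
  have \<theta>: "0 \<le> \<theta> x" "\<theta> x \<le> 1" "0 \<le> \<theta>' x" "\<theta>' x \<le> 1" for x
    using assms by (auto simp: lip_multiplier_def)
  show "0 \<le> B + B'" using assms by (simp add: lip_multiplier_def)
  show "0 \<le> \<theta> x * \<theta>' x" for x using \<theta> by simp
  show "\<theta> x * \<theta>' x \<le> 1" for x using \<theta> by (simp add: mult_le_one)
  fix x y
  have "\<bar>\<theta> x * \<theta>' x - \<theta> y * \<theta>' y\<bar> = \<bar>(\<theta> x - \<theta> y) * \<theta>' x + \<theta> y * (\<theta>' x - \<theta>' y)\<bar>"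
    by (simp add: algebra_simps)
  also have "\<dots> \<le> \<bar>\<theta> x - \<theta> y\<bar> * \<theta>' x + \<theta> y * \<bar>\<theta>' x - \<theta>' y\<bar>"
    using \<theta> by (intro order_trans[OF abs_triangle_ineq]) (simp add: abs_mult)
  also have "\<dots> \<le> \<bar>\<theta> x - \<theta> y\<bar> + \<bar>\<theta>' x - \<theta>' y\<bar>"
    using \<theta> by (intro add_mono mult_left_le mult_left_le_one_le) auto
  finally have "\<bar>\<theta> x * \<theta>' x - \<theta> y * \<theta>' y\<bar> * dist x base_point
      \<le> (\<bar>\<theta> x - \<theta> y\<bar> + \<bar>\<theta>' x - \<theta>' y\<bar>) * dist x base_point"
    by (intro mult_right_mono) auto
  moreover have "\<bar>\<theta> x - \<theta> y\<bar> * dist x base_point \<le> B * dist x y"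
      "\<bar>\<theta>' x - \<theta>' y\<bar> * dist x base_point \<le> B' * dist x y"
    using assms by (simp_all add: lip_multiplier_def)
  ultimately show "\<bar>\<theta> x * \<theta>' x - \<theta> y * \<theta>' y\<bar> * dist x base_point \<le> (B + B') * dist x y"
    by (simp add: distrib_right)
qed

text \<open>Product rule. As the \<open>g k\<close> vanish at the base point, their absolute sum at
  \<open>x\<close> is at most \<open>C * dist x base_point\<close>, which the inequality defining
  \<open>lip_multiplier\<close> absorbs. With one point outside \<open>A\<close>, only the variation
  of \<open>\<theta>\<close> remains.\<close>

lemma sum_lipschitz_multiplier:
  assumes C: "0 \<le> C" and g: "\<And>x y. x \<in> A \<Longrightarrow> y \<in> A \<Longrightarrow> (\<Sum>k\<in>K. \<bar>g k x - g k y\<bar>) \<le> C * dist x y"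
    and base: "base_point \<in> A" "\<And>k. k \<in> K \<Longrightarrow> g k base_point = 0"
    and \<theta>: "lip_multiplier B \<theta>" "\<And>x. x \<notin> A \<Longrightarrow> \<theta> x = 0"
  shows "(\<Sum>k\<in>K. \<bar>\<theta> x * g k x - \<theta> y * g k y\<bar>) \<le> C * (1 + B) * dist x y"
proof -
  have B: "0 \<le> B" and \<theta>01: "0 \<le> \<theta> x" "\<theta> x \<le> 1" for x
    using \<theta>(1) by (auto simp: lip_multiplier_def)
  have g0: "(\<Sum>k\<in>K. \<bar>g k x\<bar>) \<le> C * dist x base_point" if "x \<in> A" for x
    using g[OF that base(1)] base(2) by simp
  have \<theta>d: "(\<Sum>k\<in>K. \<bar>g k x\<bar>) * \<bar>\<theta> x - \<theta> y\<bar> \<le> C * B * dist x y" if "x \<in> A" for x y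
  proof -
    have "(\<Sum>k\<in>K. \<bar>g k x\<bar>) * \<bar>\<theta> x - \<theta> y\<bar> \<le> C * dist x base_point * \<bar>\<theta> x - \<theta> y\<bar>"
      using g0[OF that] by (intro mult_right_mono) auto
    also have "\<dots> = C * (\<bar>\<theta> x - \<theta> y\<bar> * dist x base_point)" by simp
    also have "\<dots> \<le> C * (B * dist x y)"
      using \<theta>(1) C by (intro mult_left_mono) (auto simp: lip_multiplier_def)
    finally show ?thesis by simp
  qed
  have one: "(\<Sum>k\<in>K. \<bar>\<theta> x * g k x - \<theta> y * g k y\<bar>) \<le> C * (1 + B) * dist x y" if "x \<in> A" for x y
  proof (cases "y \<in> A")
    case True
    have "(\<Sum>k\<in>K. \<bar>\<theta> x * g k x - \<theta> y * g k y\<bar>)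
        \<le> (\<Sum>k\<in>K. \<bar>g k x - g k y\<bar> + \<bar>g k x\<bar> * \<bar>\<theta> x - \<theta> y\<bar>)"
    proof (rule sum_mono)
      fix k
      have "\<theta> x * g k x - \<theta> y * g k y = \<theta> y * (g k x - g k y) + g k x * (\<theta> x - \<theta> y)"
        by (simp add: algebra_simps)
      also have "\<bar>\<dots>\<bar> \<le> \<theta> y * \<bar>g k x - g k y\<bar> + \<bar>g k x\<bar> * \<bar>\<theta> x - \<theta> y\<bar>"
        using \<theta>01[of y] by (intro order_trans[OF abs_triangle_ineq]) (simp add: abs_mult)
      also have "\<dots> \<le> \<bar>g k x - g k y\<bar> + \<bar>g k x\<bar> * \<bar>\<theta> x - \<theta> y\<bar>"
        using \<theta>01[of y] by (intro add_mono mult_left_le_one_le) auto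
      finally show "\<bar>\<theta> x * g k x - \<theta> y * g k y\<bar> \<le> \<bar>g k x - g k y\<bar> + \<bar>g k x\<bar> * \<bar>\<theta> x - \<theta> y\<bar>" .
    qed
    also have "\<dots> = (\<Sum>k\<in>K. \<bar>g k x - g k y\<bar>) + (\<Sum>k\<in>K. \<bar>g k x\<bar>) * \<bar>\<theta> x - \<theta> y\<bar>"
      by (simp add: sum.distrib sum_distrib_right)
    also have "\<dots> \<le> C * dist x y + C * B * dist x y"
      using g[OF that True] \<theta>d[OF that] by (rule add_mono)
    finally show ?thesis by (simp add: algebra_simps)
  next
    case False
    have "(\<Sum>k\<in>K. \<bar>\<theta> x * g k x - \<theta> y * g k y\<bar>) = (\<Sum>k\<in>K. \<bar>g k x\<bar>) * \<bar>\<theta> x - \<theta> y\<bar>"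
      using \<theta>(2)[OF False] \<theta>01[of x] by (simp add: abs_mult sum_distrib_left mult.commute)
    also have "\<dots> \<le> C * B * dist x y" by (rule \<theta>d[OF that])
    also have "\<dots> \<le> C * (1 + B) * dist x y"
      using C B by (intro mult_right_mono mult_left_mono) auto
    finally show ?thesis .
  qed
  consider "x \<in> A" | "y \<in> A" | "x \<notin> A" "y \<notin> A" by blast
  then show ?thesis
  proof cases
    case 2
    have "(\<Sum>k\<in>K. \<bar>\<theta> y * g k y - \<theta> x * g k x\<bar>) \<le> C * (1 + B) * dist y x"
      by (rule one[OF 2])
    then show ?thesis
      by (simp add: abs_minus_commute dist_commute)
  qed (use one \<theta>(2) C B in auto)
qed

text \<open>Meaningful when the product is again Lipschitz, which \<open>lip_multiplier\<close>
  guarantees.\<close>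

definition lip0_mult :: "('a::pointed_metric_space \<Rightarrow> real) \<Rightarrow> 'a lip0 \<Rightarrow> 'a lip0" where
  "lip0_mult \<theta> f = Lip0 (\<lambda>x. \<theta> x * lip0_apply f x)"

lemma lip0_mult:
  assumes "lip_multiplier B \<theta>"
  shows "lip0_apply (lip0_mult \<theta> f) x = \<theta> x * lip0_apply f x"
    and "norm (lip0_mult \<theta> f) \<le> norm f * (1 + B)"
proof -
  have "\<bar>\<theta> x * lip0_apply f x - \<theta> y * lip0_apply f y\<bar> \<le> norm f * (1 + B) * dist x y" for x y
    using sum_lipschitz_multiplier[of "norm f" UNIV "\<lambda>_. lip0_apply f" "{()}" B \<theta> x y] assms
    by (simp add: lip0_diff_le)
  moreover have "0 \<le> norm f * (1 + B)" using assms by (simp add: lip_multiplier_def)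
  ultimately show "lip0_apply (lip0_mult \<theta> f) x = \<theta> x * lip0_apply f x"
      "norm (lip0_mult \<theta> f) \<le> norm f * (1 + B)"
    unfolding lip0_mult_def by (simp_all add: lip0_apply_Lip0)
qed

text \<open>Distance to \<open>E\<close> relative to the distance from the base point, so that
  cutoffs built on it are multipliers even far away. The summand 1 prevents division by 0 at the
  base point.\<close>

definition rel_dist :: "'a::pointed_metric_space set \<Rightarrow> 'a \<Rightarrow> real" where
  "rel_dist E x = infdist x E / (1 + dist x base_point)"

lemma rel_dist_nonneg: "0 \<le> rel_dist E x"
  by (simp add: rel_dist_def infdist_nonneg)

lemma rel_dist_mem: "x \<in> E \<Longrightarrow> rel_dist E x = 0"
  by (simp add: rel_dist_def)

lemma rel_dist_antimono: "E \<subseteq> E' \<Longrightarrow> E \<noteq> {} \<Longrightarrow> rel_dist E' x \<le> rel_dist E x"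
  unfolding rel_dist_def by (intro divide_right_mono infdist_mono) auto

lemma continuous_on_rel_dist: "continuous_on UNIV (rel_dist E)"
  unfolding rel_dist_def [abs_def]
proof (intro continuous_intros ballI)
  show "1 + dist x base_point \<noteq> 0" for x :: 'a
    using zero_le_dist[of x base_point] by linarith
qed

text \<open>Multiplied by \<open>1 + dist x base_point\<close>, the difference splits into a
  difference of distances to \<open>E\<close> and \<open>rel_dist E y\<close> times a difference of
  distances to the base point. Both are at most \<open>dist x y\<close>, since
  \<open>base_point \<in> E\<close> gives \<open>rel_dist E y \<le> 1\<close>.\<close>

lemma rel_dist_diff_le:
  assumes "base_point \<in> E"
  shows "\<bar>rel_dist E x - rel_dist E y\<bar> * dist x base_point \<le> 2 * dist x y"
proof -
  let ?b = "\<lambda>x. 1 + dist x base_point"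
  have pos: "0 < ?b x" for x :: 'a
    using zero_le_dist[of x base_point] by linarith
  have infdist_eq: "infdist z E = rel_dist E z * ?b z" for z
    using pos[of z] by (simp add: rel_dist_def)
  have le1: "rel_dist E y \<le> 1"
    using infdist_le[OF assms, of y] pos[of y] by (simp add: rel_dist_def divide_le_eq)
  have "(rel_dist E x - rel_dist E y) * ?b x
      = infdist x E - infdist y E + rel_dist E y * (dist y base_point - dist x base_point)"
    by (simp add: infdist_eq algebra_simps)
  also have "\<bar>\<dots>\<bar> \<le> \<bar>infdist x E - infdist y E\<bar> + rel_dist E y * \<bar>dist y base_point - dist x base_point\<bar>"
    using rel_dist_nonneg[of E y] by (intro order_trans[OF abs_triangle_ineq]) (simp add: abs_mult)
  also have "\<dots> \<le> dist x y + 1 * dist x y"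
  proof (intro add_mono mult_mono le1)
    show "\<bar>infdist x E - infdist y E\<bar> \<le> dist x y" by (rule infdist_triangle_abs)
    show "\<bar>dist y base_point - dist x base_point\<bar> \<le> dist x y"
      using dist_triangle[of x base_point y] dist_triangle[of y base_point x]
      by (simp add: dist_commute abs_le_iff)
  qed auto
  finally have "\<bar>rel_dist E x - rel_dist E y\<bar> * ?b x \<le> 2 * dist x y"
    using pos[of x] by (simp add: abs_mult)
  moreover have "\<bar>rel_dist E x - rel_dist E y\<bar> * dist x base_point \<le> \<bar>rel_dist E x - rel_dist E y\<bar> * ?b x"
    by (intro mult_left_mono) auto
  ultimately show ?thesis by linarith
qed

section \<open>Cutoffs and humps with disjoint supports\<close>

definition plateau :: "'a::pointed_metric_space set \<Rightarrow> real \<Rightarrow> 'a \<Rightarrow> real" where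
  "plateau E \<delta> x = max 0 (min 1 (2 - rel_dist E x / \<delta>))"

lemma plateau_eq_1: "0 < \<delta> \<Longrightarrow> rel_dist E x \<le> \<delta> \<Longrightarrow> plateau E \<delta> x = 1"
  by (simp add: plateau_def field_simps)

lemma plateau_eq_0: "0 < \<delta> \<Longrightarrow> 2 * \<delta> \<le> rel_dist E x \<Longrightarrow> plateau E \<delta> x = 0"
  by (simp add: plateau_def field_simps)

lemma lip_multiplier_plateau:
  assumes "base_point \<in> E" "0 < \<delta>"
  shows "lip_multiplier (2 / \<delta>) (plateau E \<delta>)"
  unfolding lip_multiplier_def
proof (intro conjI allI)
  fix x y
  have "\<bar>plateau E \<delta> x - plateau E \<delta> y\<bar> \<le> \<bar>rel_dist E x / \<delta> - rel_dist E y / \<delta>\<bar>"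
    unfolding plateau_def by linarith
  also have "\<dots> = \<bar>rel_dist E x - rel_dist E y\<bar> / \<delta>"
    using assms(2) by (simp add: diff_divide_distrib[symmetric])
  finally have "\<bar>plateau E \<delta> x - plateau E \<delta> y\<bar> * dist x base_point
      \<le> \<bar>rel_dist E x - rel_dist E y\<bar> / \<delta> * dist x base_point"
    by (intro mult_right_mono) auto
  also have "\<dots> \<le> 2 * dist x y / \<delta>"
    using rel_dist_diff_le[OF assms(1), of x y] assms(2) by (simp add: divide_right_mono)
  finally show "\<bar>plateau E \<delta> x - plateau E \<delta> y\<bar> * dist x base_point \<le> 2 / \<delta> * dist x y"
    by simp
qed (use assms in \<open>auto simp: plateau_def\<close>)

text \<open>At each point at most one function is nonzero, so for a pair of points at most two terms
  of the sum survive.\<close>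

lemma sum_lipschitz_disjoint:
  assumes lip: "\<And>k x y. \<bar>g k x - g k y\<bar> \<le> C * dist x y"
    and disj: "\<And>k l x. k < l \<Longrightarrow> g k x = 0 \<or> g l x = 0"
  shows "sum_lipschitz (2 * C) g"
  unfolding sum_lipschitz_def
proof (intro allI)
  fix n x y
  have disj': "g k z = 0 \<or> g l z = 0" if "k \<noteq> l" for k l z
    using disj[of k l z] disj[of l k z] that by (cases "k < l") auto
  have "\<exists>i. \<forall>k. k \<noteq> i \<longrightarrow> g k z = 0" for z
    using disj'[of _ _ z] by metis
  then obtain i j where i: "\<And>k. k \<noteq> i \<Longrightarrow> g k x = 0" and j: "\<And>k. k \<noteq> j \<Longrightarrow> g k y = 0"
    by metis
  have "(\<Sum>k<n. \<bar>g k x - g k y\<bar>) = (\<Sum>k\<in>{..<n} \<inter> {i, j}. \<bar>g k x - g k y\<bar>)"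
    using i j by (intro sum.mono_neutral_right) auto
  also have "\<dots> \<le> (\<Sum>k\<in>{i, j}. \<bar>g k x - g k y\<bar>)"
    by (intro sum_mono2) auto
  also have "\<dots> \<le> \<bar>g i x - g i y\<bar> + \<bar>g j x - g j y\<bar>"
    by (cases "i = j") auto
  also have "\<dots> \<le> 2 * C * dist x y"
    using lip[of i x y] lip[of j x y] by simp
  finally show "(\<Sum>k<n. \<bar>g k x - g k y\<bar>) \<le> 2 * C * dist x y" .
qed

text \<open>Gliding humps. If no \<open>E\<close> works, each \<open>E\<close> admits a function
  supported away from \<open>E\<close> on which some element of \<open>\<Gamma>\<close> is large.
  That element is nearly finitely supported, so the function can also be cut off near a larger
  finite set \<open>E'\<close>. Repeating this yields disjoint supports and a contradiction.\<close>

lemma V_star_set_tight_step: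
  fixes \<Gamma> :: "'a::pointed_metric_space lipschitz_free set"
  assumes \<Gamma>: "V_star_set \<Gamma>" and \<rho>: "lip_multiplier B \<rho>" and \<delta>: "0 < \<delta>" and \<epsilon>: "0 < \<epsilon>"
  obtains E where "finite E" "base_point \<in> E"
    "\<And>u f. u \<in> \<Gamma> \<Longrightarrow> norm f \<le> 1 \<Longrightarrow>
      \<bar>free_to_dual u (lip0_mult (\<lambda>x. \<rho> x * (1 - plateau E \<delta> x)) f)\<bar> \<le> \<epsilon>"
proof (rule ccontr)
  note witness = that
  assume "\<not> thesis"
  then have neg: "\<exists>u f. u \<in> \<Gamma> \<and> norm f \<le> 1 \<and>
      \<epsilon> < \<bar>free_to_dual u (lip0_mult (\<lambda>x. \<rho> x * (1 - plateau E \<delta> x)) f)\<bar>"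
    if "finite E" "base_point \<in> E" for E
    by (metis not_le that witness)
  \<comment> \<open>Bounds the norms after cutting off. The last summand comes from a plateau at
    scale \<open>\<delta> / 2\<close>, which vanishes unless
    \<open>rel_dist E' x < \<delta>\<close>.\<close>
  define C where "C = 1 + (B + 2 / \<delta> + 2 / (\<delta> / 2))"
  have B: "0 \<le> B" using \<rho> by (simp add: lip_multiplier_def)
  have C: "1 \<le> C" using B \<delta> by (simp add: C_def)
  have hump: "\<exists>E' g u. finite E' \<and> E \<subseteq> E' \<and> u \<in> \<Gamma> \<and> norm g \<le> C \<and> \<epsilon> / 2 \<le> \<bar>free_to_dual u g\<bar> \<and>
      (\<forall>x. lip0_apply g x \<noteq> 0 \<longrightarrow> \<delta> < rel_dist E x \<and> rel_dist E' x < \<delta>)"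
    if E: "finite E" "base_point \<in> E" for E
  proof -
    obtain u f where u: "u \<in> \<Gamma>" and f: "norm f \<le> 1"
        and big: "\<epsilon> < \<bar>free_to_dual u (lip0_mult (\<lambda>x. \<rho> x * (1 - plateau E \<delta> x)) f)\<bar>"
      using neg[OF E] by blast
    have "0 < \<epsilon> / (4 * C)" using \<epsilon> C by simp
    then obtain E0 D where E0: "finite E0" "0 \<le> D"
      "\<And>h s. 0 \<le> s \<Longrightarrow> (\<And>e. e \<in> E0 \<Longrightarrow> \<bar>lip0_apply h e\<bar> \<le> s) \<Longrightarrow>
        \<bar>free_to_dual u h\<bar> \<le> \<epsilon> / (4 * C) * norm h + D * s"
      by (rule free_finite_support[where u = u]) blast
    define E' where "E' = E \<union> E0"
    have E': "finite E'" "base_point \<in> E'" "E \<subseteq> E'" "E0 \<subseteq> E'"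
      using E E0(1) by (auto simp: E'_def)
    let ?\<theta> = "\<lambda>x. \<rho> x * (1 - plateau E \<delta> x)" and ?\<theta>' = "\<lambda>x. \<rho> x * (1 - plateau E \<delta> x) * plateau E' (\<delta> / 2) x"
    have \<theta>: "lip_multiplier (B + 2 / \<delta>) ?\<theta>"
      by (intro lip_multiplier_mult lip_multiplier_complement \<rho> lip_multiplier_plateau E \<delta>)
    have \<theta>': "lip_multiplier (B + 2 / \<delta> + 2 / (\<delta> / 2)) ?\<theta>'"
      by (intro lip_multiplier_mult[OF \<theta>] lip_multiplier_plateau E') (use \<delta> in auto)
    define g where "g = lip0_mult ?\<theta>' f"
    have ng: "norm g \<le> C"
    proof -
      have "norm g \<le> norm f * C"
        using lip0_mult(2)[OF \<theta>', of f] by (simp add: g_def C_def)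
      also have "\<dots> \<le> 1 * C" using f C by (intro mult_right_mono) auto
      finally show ?thesis by simp
    qed
    have nh: "norm (lip0_mult ?\<theta> f) \<le> C"
    proof -
      have "norm (lip0_mult ?\<theta> f) \<le> norm f * (1 + (B + 2 / \<delta>))"
        by (rule lip0_mult(2)[OF \<theta>])
      also have "\<dots> \<le> 1 * C"
      proof (rule mult_mono)
        have "0 \<le> 2 / (\<delta> / 2)" using \<delta> by simp
        then show "1 + (B + 2 / \<delta>) \<le> C" unfolding C_def by linarith
      qed (use f B \<delta> in auto)
      finally show ?thesis by simp
    qed
    \<comment> \<open>Both cutoffs agree on \<open>E0\<close>, where the plateau of
      \<open>E'\<close> is 1; hence the error term with \<open>D\<close> is 0.\<close>
    have "\<bar>free_to_dual u (lip0_mult ?\<theta> f - g)\<bar> \<le> \<epsilon> / (4 * C) * norm (lip0_mult ?\<theta> f - g) + D * 0"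
    proof (rule E0(3))
      fix e assume "e \<in> E0"
      then have "plateau E' (\<delta> / 2) e = 1"
        using E'(4) \<delta> by (intro plateau_eq_1) (auto simp: rel_dist_mem)
      then show "\<bar>lip0_apply (lip0_mult ?\<theta> f - g) e\<bar> \<le> 0"
        by (simp add: g_def minus_lip0.rep_eq lip0_mult(1)[OF \<theta>] lip0_mult(1)[OF \<theta>'])
    qed simp
    also have "\<dots> \<le> \<epsilon> / (4 * C) * (2 * C)"
      using norm_triangle_ineq4[of "lip0_mult ?\<theta> f" g] ng nh \<epsilon> C
      by (simp add: mult_left_mono del: times_divide_eq_left)
    also have "\<dots> = \<epsilon> / 2" using C by simp
    finally have "\<epsilon> / 2 \<le> \<bar>free_to_dual u g\<bar>"
      using big unfolding blinfun.diff_right by linarith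
    moreover have "\<delta> < rel_dist E x \<and> rel_dist E' x < \<delta>" if "lip0_apply g x \<noteq> 0" for x
    proof -
      have "plateau E \<delta> x \<noteq> 1" "plateau E' (\<delta> / 2) x \<noteq> 0"
        using that by (auto simp: g_def lip0_mult(1)[OF \<theta>'])
      then show ?thesis
        using plateau_eq_1[of \<delta> E x] plateau_eq_0[of "\<delta> / 2" E' x] \<delta> by force
    qed
    ultimately show ?thesis using E' u ng by blast
  qed
  define P where "P n z \<longleftrightarrow> finite (fst z) \<and> base_point \<in> fst z \<and> norm (snd z) \<le> C \<and>
      (\<exists>u\<in>\<Gamma>. \<epsilon> / 2 \<le> \<bar>free_to_dual u (snd z)\<bar>) \<and>
      (\<forall>x. lip0_apply (snd z) x \<noteq> 0 \<longrightarrow> rel_dist (fst z) x < \<delta>)" for n :: nat and z :: "'a set \<times> 'a lip0"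
  define Q where "Q n z z' \<longleftrightarrow> fst z \<subseteq> fst z' \<and> (\<forall>x. lip0_apply (snd z') x \<noteq> 0 \<longrightarrow> \<delta> < rel_dist (fst z) x)"
    for n :: nat and z z' :: "'a set \<times> 'a lip0"
  have "\<exists>z. P 0 z"
  proof -
    obtain E' g u where "finite E'" "{base_point} \<subseteq> E'" "u \<in> \<Gamma>" "norm g \<le> C" "\<epsilon> / 2 \<le> \<bar>free_to_dual u g\<bar>"
      "\<forall>x. lip0_apply g x \<noteq> 0 \<longrightarrow> \<delta> < rel_dist {base_point} x \<and> rel_dist E' x < \<delta>"
      using hump[of "{base_point}"] by auto
    then show ?thesis by (intro exI[of _ "(E', g)"]) (auto simp: P_def)
  qed
  moreover have "\<exists>z'. P (Suc n) z' \<and> Q n z z'" if z: "P n z" for n z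
  proof -
    obtain E' g u where "finite E'" "fst z \<subseteq> E'" "u \<in> \<Gamma>" "norm g \<le> C" "\<epsilon> / 2 \<le> \<bar>free_to_dual u g\<bar>"
      "\<forall>x. lip0_apply g x \<noteq> 0 \<longrightarrow> \<delta> < rel_dist (fst z) x \<and> rel_dist E' x < \<delta>"
      using hump[of "fst z"] z by (auto simp: P_def)
    with z show ?thesis by (intro exI[of _ "(E', g)"]) (auto simp: P_def Q_def)
  qed
  ultimately obtain Z where PZ: "\<And>n. P n (Z n)" and QZ: "\<And>n. Q n (Z n) (Z (Suc n))"
    using dependent_nat_choice[of P Q] by metis
  define E where "E n = fst (Z n)" for n
  define g where "g n = snd (Z n)" for n
  have E_mono: "E k \<subseteq> E l" if "k \<le> l" for k l
    using QZ by (intro lift_Suc_mono_le[OF _ that]) (auto simp: Q_def E_def)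
  have "sum_lipschitz (2 * C) (\<lambda>k. lip0_apply (g k))"
  proof (rule sum_lipschitz_disjoint)
    fix k x y
    show "\<bar>lip0_apply (g k) x - lip0_apply (g k) y\<bar> \<le> C * dist x y"
      using lip0_diff_le[of "g k" x y] mult_right_mono[of "norm (g k)" C "dist x y"] PZ[of k]
      by (auto simp: P_def g_def)
  next
    fix k l :: nat and x assume "k < l"
    \<comment> \<open>Hump \<open>l\<close> avoids the neighbourhood of \<open>E m\<close>, the set
      of its predecessor, which contains \<open>E k\<close>.\<close>
    then obtain m where l: "l = Suc m" "k \<le> m" by (cases l) auto
    show "lip0_apply (g k) x = 0 \<or> lip0_apply (g l) x = 0"
    proof (rule ccontr)
      assume "\<not> ?thesis"
      then have "rel_dist (E k) x < \<delta>" "\<delta> < rel_dist (E m) x"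
        using PZ[of k] QZ[of m] l by (auto simp: P_def Q_def E_def g_def)
      moreover have "rel_dist (E m) x \<le> rel_dist (E k) x"
        using E_mono[OF l(2)] PZ[of k] by (intro rel_dist_antimono) (auto simp: P_def E_def)
      ultimately show False by simp
    qed
  qed
  then obtain N where N: "\<forall>n\<ge>N. \<forall>u\<in>\<Gamma>. \<bar>free_to_dual u (g n)\<bar> < \<epsilon> / 2"
    using V_star_set_sum_lipschitz[OF \<Gamma>, of "2 * C" g "\<epsilon> / 2"] C \<epsilon> by auto
  then show False
    using PZ[of N] by (force simp: P_def g_def)
qed

text \<open>Rounding \<open>v x h / \<kappa>\<close> down to integers leaves finitely many patterns;
  \<open>K\<close> has a representative of each.\<close>

lemma bounded_finite_net:
  fixes v :: "'x \<Rightarrow> 'h \<Rightarrow> real"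
  assumes H: "finite H" and R: "\<And>x h. x \<in> G \<Longrightarrow> h \<in> H \<Longrightarrow> \<bar>v x h\<bar> \<le> R" and \<kappa>: "0 < \<kappa>"
  obtains K where "finite K" "K \<subseteq> G" "\<And>x. x \<in> G \<Longrightarrow> \<exists>y\<in>K. \<forall>h\<in>H. \<bar>v x h - v y h\<bar> < \<kappa>"
proof -
  define \<Theta> where "\<Theta> x = restrict (\<lambda>h. \<lfloor>v x h / \<kappa>\<rfloor>) H" for x
  have "\<Theta> x \<in> PiE H (\<lambda>_. {\<lfloor>-R / \<kappa>\<rfloor>..\<lfloor>R / \<kappa>\<rfloor>})" if "x \<in> G" for x
  proof -
    have "-R / \<kappa> \<le> v x h / \<kappa> \<and> v x h / \<kappa> \<le> R / \<kappa>" if "h \<in> H" for h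
      using R[OF \<open>x \<in> G\<close> that] \<kappa> by (intro conjI divide_right_mono) auto
    then show ?thesis by (auto simp: \<Theta>_def floor_mono)
  qed
  then have "\<Theta> ` G \<subseteq> PiE H (\<lambda>_. {\<lfloor>-R / \<kappa>\<rfloor>..\<lfloor>R / \<kappa>\<rfloor>})" by blast
  then have "finite (\<Theta> ` G)"
    using finite_PiE[OF H, of "\<lambda>_. {\<lfloor>-R / \<kappa>\<rfloor>..\<lfloor>R / \<kappa>\<rfloor>}"] by (auto intro: finite_subset)
  then obtain K where K: "K \<subseteq> G" "finite K" "\<Theta> ` G = \<Theta> ` K"
    using finite_subset_image[of "\<Theta> ` G" \<Theta> G] by auto
  show thesis
  proof (rule that[OF K(2,1)])
    fix x assume "x \<in> G"
    then obtain y where y: "y \<in> K" "\<Theta> x = \<Theta> y" using K(3) by blast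
    have "\<bar>v x h - v y h\<bar> < \<kappa>" if "h \<in> H" for h
    proof -
      have "\<lfloor>v x h / \<kappa>\<rfloor> = \<lfloor>v y h / \<kappa>\<rfloor>"
        using fun_cong[OF y(2), of h] that by (simp add: \<Theta>_def)
      then have "\<bar>v x h / \<kappa> - v y h / \<kappa>\<bar> < 1" by linarith
      then have "\<bar>v x h - v y h\<bar> / \<kappa> < 1"
        using \<kappa> by (simp add: diff_divide_distrib[symmetric])
      then show ?thesis using \<kappa> by simp
    qed
    with y(1) show "\<exists>y\<in>K. \<forall>h\<in>H. \<bar>v x h - v y h\<bar> < \<kappa>" by blast
  qed
qed

section \<open>Localization on a compact set\<close>

lemma compact_closure_totally_bounded:
  fixes X :: "'a::metric_space set"
  assumes "complete (UNIV :: 'a set)" and X: "\<And>e. 0 < e \<Longrightarrow> \<exists>k. finite k \<and> X \<subseteq> (\<Union>z\<in>k. ball z e)"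
  shows "compact (closure X)"
  unfolding compact_eq_totally_bounded
proof (intro conjI allI impI)
  show "complete (closure X)"
    using complete_closed_subset[OF closed_closure subset_UNIV assms(1)] .
  fix e :: real assume "0 < e"
  then obtain k where k: "finite k" "X \<subseteq> (\<Union>z\<in>k. ball z (e / 2))" using X[of "e / 2"] by auto
  have "X \<subseteq> (\<Union>z\<in>k. cball z (e / 2))" using k(2) by force
  then have "closure X \<subseteq> (\<Union>z\<in>k. cball z (e / 2))"
    using k(1) by (intro closure_minimal) auto
  also have "\<dots> \<subseteq> (\<Union>z\<in>k. ball z e)" using \<open>0 < e\<close> by force
  finally show "\<exists>k. finite k \<and> closure X \<subseteq> (\<Union>z\<in>k. ball z e)" using k(1) by blast
qed

text \<open>The sets decrease to a compact \<open>K\<close>, which by local compactness has a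
  neighbourhood covered by a compact set. Points of ever later sets outside that neighbourhood would
  accumulate in \<open>K\<close>, so one of the sets already lies inside it.\<close>

lemma rel_dist_localization:
  fixes E :: "nat \<Rightarrow> 'a::pointed_metric_space set"
  assumes compl: "complete (UNIV :: 'a set)" and lc: "locally compact (UNIV :: 'a set)"
    and E: "\<And>n. finite (E n)" "\<And>n. base_point \<in> E n"
    and \<delta>: "\<And>n. 0 < \<delta> n" "\<delta> 0 \<le> 1 / 4" "\<delta> \<longlonglongrightarrow> 0"
  shows "\<exists>n. compact {x. \<forall>k<n. rel_dist (E k) x \<le> 2 * \<delta> k}"
proof -
  define A where "A n = {x. \<forall>k<n. rel_dist (E k) x \<le> 2 * \<delta> k}" for n
  have A_closed: "closed (A n)" for n
  proof -
    have "A n = (\<Inter>k<n. {x. rel_dist (E k) x \<le> 2 * \<delta> k})" by (auto simp: A_def)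
    then show ?thesis by (auto intro!: closed_Collect_le continuous_on_rel_dist)
  qed
  have A_mono: "A n \<subseteq> A m" if "m \<le> n" for m n
    using that by (auto simp: A_def)
  define R where "R = (\<Sum>z\<in>E 0. dist z base_point)"
  have R: "dist z base_point \<le> R" if "z \<in> E 0" for z
    unfolding R_def by (rule member_le_sum) (use that E(1) in auto)
  \<comment> \<open>The condition at \<open>k = 0\<close>, with
    \<open>2 * \<delta> 0 \<le> 1 / 2\<close>, bounds the distance from the base point; this
    converts relative smallness into absolute smallness below.\<close>
  have A1: "dist x base_point \<le> 1 + 2 * R" if "x \<in> A (Suc n)" for x n
  proof -
    have pos: "0 < 1 + dist x base_point" using zero_le_dist[of x base_point] by linarith
    have "dist x base_point - R \<le> infdist x (E 0)"
    proof -
      have "dist x base_point - R \<le> dist x z" if "z \<in> E 0" for z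
        using R[OF that] dist_triangle[of x base_point z] by simp
      then show ?thesis
        using E(2)[of 0] by (auto simp: infdist_def intro!: cINF_greatest)
    qed
    also have "\<dots> = rel_dist (E 0) x * (1 + dist x base_point)"
      using pos by (simp add: rel_dist_def)
    also have "\<dots> \<le> 1 / 2 * (1 + dist x base_point)"
    proof (rule mult_right_mono)
      have "rel_dist (E 0) x \<le> 2 * \<delta> 0" using that by (auto simp: A_def)
      then show "rel_dist (E 0) x \<le> 1 / 2" using \<delta>(2) by linarith
    qed (use pos in auto)
    finally show ?thesis by simp
  qed
  have R0: "0 \<le> R" unfolding R_def by (simp add: sum_nonneg)
  \<comment> \<open>Finite exceptions are allowed so that this covers \<open>K\<close> as well as
    the range of a sequence with \<open>x n \<in> A n\<close>.\<close>
  have totally_bounded: "compact (closure X)" if X: "\<And>n. finite (X - A n)" for X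
  proof (rule compact_closure_totally_bounded[OF compl])
    fix e :: real assume "0 < e"
    then have "0 < e / (4 * (1 + R))" using R0 by (intro divide_pos_pos) auto
    then obtain n where n: "\<delta> n < e / (4 * (1 + R))"
      using order_tendstoD(2)[OF \<delta>(3)] by (metis eventually_sequentially order_refl)
    have "x \<in> (\<Union>z\<in>E n. ball z e)" if "x \<in> A (Suc n)" for x
    proof -
      have pos: "0 < 1 + dist x base_point" using zero_le_dist[of x base_point] by linarith
      have "infdist x (E n) = rel_dist (E n) x * (1 + dist x base_point)"
        using pos by (simp add: rel_dist_def)
      also have "\<dots> \<le> 2 * \<delta> n * (2 * (1 + R))"
        using that A1[OF that] pos \<delta>(1)[of n] by (intro mult_mono) (auto simp: A_def)
      also have "\<dots> < e"
        using n R0 by (simp add: field_simps)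
      finally have "infdist x (E n) < e" .
      moreover have "E n \<noteq> {}" using E(2)[of n] by blast
      ultimately have "\<exists>z\<in>E n. dist x z < e"
        by (simp add: infdist_notempty cINF_less_iff)
      then show ?thesis by (auto simp: dist_commute)
    qed
    moreover have "x \<in> (\<Union>z\<in>X - A (Suc n). ball z e)" if "x \<in> X - A (Suc n)" for x
      using that \<open>0 < e\<close> by (intro UN_I[of x]) auto
    ultimately have "X \<subseteq> (\<Union>z\<in>E n \<union> (X - A (Suc n)). ball z e)"
      by blast
    moreover have "finite (E n \<union> (X - A (Suc n)))" using E(1) X by auto
    ultimately show "\<exists>k. finite k \<and> X \<subseteq> (\<Union>z\<in>k. ball z e)" by blast
  qed
  define K where "K = (\<Inter>n. A n)"
  have "finite (K - A n)" for n
    by (rule finite_subset[of _ "{}"]) (auto simp: K_def)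
  then have cK: "compact K"
    using totally_bounded[of K] A_closed by (simp add: K_def closed_INT closure_closed)
  have "\<exists>U V. open U \<and> compact V \<and> x \<in> U \<and> U \<subseteq> V" for x :: 'a
    using lc unfolding locally_def by (metis UNIV_I open_UNIV openin_open_eq subtopology_UNIV open_openin)
  then obtain U V where UV: "\<And>x :: 'a. open (U x)" "\<And>x. compact (V x)" "\<And>x. x \<in> U x" "\<And>x. U x \<subseteq> V x"
    by metis
  obtain T where T: "finite T" "K \<subseteq> (\<Union>x\<in>T. U x)"
  proof (rule compactE_image[OF cK, of K U])
    show "K \<subseteq> (\<Union>x\<in>K. U x)" using UV(3) by blast
  qed (use UV(1) in auto)
  have "\<exists>n. A n \<subseteq> (\<Union>x\<in>T. U x)"
  proof (rule ccontr)
    assume "\<not> ?thesis"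
    then have "\<forall>n. \<exists>y. y \<in> A n \<and> y \<notin> (\<Union>x\<in>T. U x)" by blast
    then obtain x where x: "\<And>n. x n \<in> A n" "\<And>n. x n \<notin> (\<Union>x\<in>T. U x)" by metis
    have "range x - A n \<subseteq> x ` {..<n}" for n
    proof clarify
      fix m assume "x m \<notin> A n"
      with x(1)[of m] A_mono[of n m] have "m < n" by (meson not_le subsetD)
      then show "x m \<in> x ` {..<n}" by blast
    qed
    then have "compact (closure (range x))"
      by (intro totally_bounded) (meson finite_imageI finite_lessThan finite_subset)
    then have sc: "seq_compact (closure (range x))" by (simp add: compact_eq_seq_compact_metric)
    have "\<forall>n. x n \<in> closure (range x)"
      by (intro allI subsetD[OF closure_subset] rangeI)
    from seq_compactE[OF sc this] obtain l r where r: "strict_mono r" "(x \<circ> r) \<longlonglongrightarrow> l" .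
    have "l \<in> A m" for m
    proof (rule closed_sequentially[OF A_closed])
      show "(\<lambda>n. (x \<circ> r) (n + m)) \<longlonglongrightarrow> l" by (rule LIMSEQ_ignore_initial_segment[OF r(2)])
      show "(x \<circ> r) (n + m) \<in> A m" for n
        using x(1)[of "r (n + m)"] A_mono[of m "r (n + m)"] seq_suble[OF r(1), of "n + m"] by auto
    qed
    then have "l \<in> K" by (simp add: K_def)
    then have "l \<in> (\<Union>x\<in>T. U x)" using T(2) by blast
    moreover have "open (\<Union>x\<in>T. U x)" using UV(1) by auto
    ultimately have "\<forall>\<^sub>F n in sequentially. (x \<circ> r) n \<in> (\<Union>x\<in>T. U x)"
      using topological_tendstoD[OF r(2)] by blast
    then show False using x(2) by (auto simp: eventually_sequentially)
  qed
  then obtain n where "A n \<subseteq> (\<Union>x\<in>T. U x)" ..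
  also have "\<dots> \<subseteq> (\<Union>x\<in>T. V x)" using UV(4) by blast
  finally have "A n = (\<Union>x\<in>T. V x) \<inter> A n" by blast
  moreover have "compact (\<Union>x\<in>T. V x)" using T(1) UV(2) by (rule compact_UN)
  ultimately have "compact (A n)" using compact_Int_closed[OF _ A_closed] by metis
  then show ?thesis unfolding A_def by blast
qed

text \<open>The cutoff is a finite product of plateaus. The factor added at step \<open>n\<close>
  costs at most \<open>\<epsilon> * (1/2) ^ Suc n\<close>, so every partial product loses at most
  \<open>\<epsilon>\<close>; by \<open>rel_dist_localization\<close> one of them vanishes outside a
  compact set.\<close>

lemma V_star_set_tight:
  fixes \<Gamma> :: "'a::pointed_metric_space lipschitz_free set"
  assumes compl: "complete (UNIV :: 'a set)" and lc: "locally compact (UNIV :: 'a set)"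
    and \<Gamma>: "V_star_set \<Gamma>" and \<epsilon>: "0 < \<epsilon>"
  obtains A \<theta> B where "compact A" "base_point \<in> A" "lip_multiplier B \<theta>" "\<And>x. x \<notin> A \<Longrightarrow> \<theta> x = 0"
    "\<And>u f. u \<in> \<Gamma> \<Longrightarrow> norm f \<le> 1 \<Longrightarrow> \<bar>free_to_dual u f - free_to_dual u (lip0_mult \<theta> f)\<bar> \<le> \<epsilon>"
proof -
  \<comment> \<open>Tends to 0 and starts at \<open>1 / 4\<close>, as
    \<open>rel_dist_localization\<close> demands.\<close>
  define \<delta> where "\<delta> n = (1 / 4) * (1 / 2 :: real) ^ n" for n :: nat
  have \<delta>: "0 < \<delta> n" "\<delta> 0 \<le> 1 / 4" for n by (auto simp: \<delta>_def)
  have "\<delta> \<longlonglongrightarrow> 1 / 4 * 0"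
    unfolding \<delta>_def [abs_def] by (intro tendsto_mult_left LIMSEQ_power_zero) simp
  then have \<delta>_lim: "\<delta> \<longlonglongrightarrow> 0" by simp
  define P where "P n z \<longleftrightarrow> finite (fst z) \<and> base_point \<in> fst z \<and> (\<exists>B. lip_multiplier B (snd z)) \<and>
      (n = 0 \<longrightarrow> snd z = (\<lambda>_. 1))"
    for n :: nat and z :: "'a set \<times> ('a \<Rightarrow> real)"
  define Q where "Q n z z' \<longleftrightarrow> snd z' = (\<lambda>x. snd z x * plateau (fst z') (\<delta> n) x) \<and>
      (\<forall>u\<in>\<Gamma>. \<forall>f. norm f \<le> 1 \<longrightarrow>
        \<bar>free_to_dual u (lip0_mult (\<lambda>x. snd z x * (1 - plateau (fst z') (\<delta> n) x)) f)\<bar> \<le> \<epsilon> * (1/2) ^ Suc n)"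
    for n :: nat and z z' :: "'a set \<times> ('a \<Rightarrow> real)"
  have "\<exists>z. P 0 z"
    by (rule exI[of _ "({base_point}, \<lambda>_. 1)"]) (auto simp: P_def intro: lip_multiplier_one)
  moreover have "\<exists>z'. P (Suc n) z' \<and> Q n z z'" if z: "P n z" for n z
  proof -
    obtain B where B: "lip_multiplier B (snd z)" using z by (auto simp: P_def)
    have "0 < \<epsilon> * (1/2) ^ Suc n" using \<epsilon> by simp
    then obtain E where E: "finite E" "base_point \<in> E" "\<And>u f. u \<in> \<Gamma> \<Longrightarrow> norm f \<le> 1 \<Longrightarrow>
        \<bar>free_to_dual u (lip0_mult (\<lambda>x. snd z x * (1 - plateau E (\<delta> n) x)) f)\<bar> \<le> \<epsilon> * (1/2) ^ Suc n"
      by (rule V_star_set_tight_step[OF \<Gamma> B \<delta>(1)[of n]]) blast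
    have "lip_multiplier (B + 2 / \<delta> n) (\<lambda>x. snd z x * plateau E (\<delta> n) x)"
      by (rule lip_multiplier_mult[OF B lip_multiplier_plateau[OF E(2) \<delta>(1)]])
    with E show ?thesis
      by (intro exI[of _ "(E, \<lambda>x. snd z x * plateau E (\<delta> n) x)"]) (auto simp: P_def Q_def)
  qed
  ultimately obtain Z where PZ: "\<And>n. P n (Z n)" and QZ: "\<And>n. Q n (Z n) (Z (Suc n))"
    using dependent_nat_choice[of P Q] by metis
  define E where "E n = fst (Z (Suc n))" for n
  define \<rho> where "\<rho> n = snd (Z n)" for n
  have E: "finite (E n)" "base_point \<in> E n" for n
    using PZ[of "Suc n"] by (auto simp: P_def E_def)
  have \<rho>0: "\<rho> 0 = (\<lambda>_. 1)" using PZ[of 0] by (simp add: P_def \<rho>_def)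
  have \<rho>_Suc: "\<rho> (Suc n) x = \<rho> n x * plateau (E n) (\<delta> n) x" for n x
    using QZ[of n] by (simp add: Q_def \<rho>_def E_def)
  have \<rho>_mult: "\<exists>B. lip_multiplier B (\<rho> n)" for n
    using PZ[of n] by (simp add: P_def \<rho>_def)
  have step: "\<bar>free_to_dual u (lip0_mult (\<rho> n) f) - free_to_dual u (lip0_mult (\<rho> (Suc n)) f)\<bar> \<le> \<epsilon> * (1/2) ^ Suc n"
    if "u \<in> \<Gamma>" "norm f \<le> 1" for u f n
  proof -
    obtain B B' where B: "lip_multiplier B (\<rho> n)" "lip_multiplier B' (\<rho> (Suc n))" using \<rho>_mult by blast
    have B'': "lip_multiplier (B + 2 / \<delta> n) (\<lambda>x. \<rho> n x * (1 - plateau (E n) (\<delta> n) x))"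
      by (intro lip_multiplier_mult B(1) lip_multiplier_complement lip_multiplier_plateau E \<delta>)
    have eq: "lip0_mult (\<lambda>x. \<rho> n x * (1 - plateau (E n) (\<delta> n) x)) f = lip0_mult (\<rho> n) f - lip0_mult (\<rho> (Suc n)) f"
      by (rule lip0_eqI)
        (simp only: minus_lip0.rep_eq lip0_mult(1)[OF B(1)] lip0_mult(1)[OF B(2)] lip0_mult(1)[OF B''] \<rho>_Suc,
          simp add: algebra_simps)
    have "\<bar>free_to_dual u (lip0_mult (\<lambda>x. \<rho> n x * (1 - plateau (E n) (\<delta> n) x)) f)\<bar> \<le> \<epsilon> * (1/2) ^ Suc n"
      using QZ[of n] that unfolding Q_def \<rho>_def E_def by blast
    then show ?thesis
      by (simp only: eq blinfun.diff_right)
  qed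
  have approx: "\<bar>free_to_dual u f - free_to_dual u (lip0_mult (\<rho> n) f)\<bar> \<le> \<epsilon> * (1 - (1/2) ^ n)"
    if "u \<in> \<Gamma>" "norm f \<le> 1" for u f n
  proof (induction n)
    case 0
    have "lip0_mult (\<rho> 0) f = f"
      by (rule lip0_eqI) (simp add: \<rho>0 lip0_mult(1)[OF lip_multiplier_one])
    then show ?case by simp
  next
    case (Suc n)
    have "\<epsilon> * (1 - (1/2) ^ n) + \<epsilon> * (1/2) ^ Suc n = \<epsilon> * (1 - (1/2) ^ Suc n)"
      by (simp add: algebra_simps)
    then show ?case using Suc.IH step[OF that, of n] by linarith
  qed
  obtain n where n: "compact {x. \<forall>k<n. rel_dist (E k) x \<le> 2 * \<delta> k}"
    using rel_dist_localization[of E \<delta>, OF compl lc E \<delta> \<delta>_lim] by blast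
  obtain B where B: "lip_multiplier B (\<rho> n)" using \<rho>_mult by blast
  show thesis
  proof (rule that[OF n _ B])
    show "base_point \<in> {x. \<forall>k<n. rel_dist (E k) x \<le> 2 * \<delta> k}"
      using E(2) \<delta>(1) by (auto simp: rel_dist_mem less_imp_le)
  next
    fix x assume x: "x \<notin> {x. \<forall>k<n. rel_dist (E k) x \<le> 2 * \<delta> k}"
    have "\<rho> m x = 0" if "k < m" "2 * \<delta> k \<le> rel_dist (E k) x" for k m
      using that(1)
    proof (induction m)
      case (Suc m)
      then show ?case
        using plateau_eq_0[OF \<delta>(1) that(2)] by (cases "k = m") (auto simp: \<rho>_Suc)
    qed simp
    with x show "\<rho> n x = 0" by (force simp: not_le)
  next
    fix u f assume "u \<in> \<Gamma>" "norm (f :: 'a lip0) \<le> 1"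
    then have "\<bar>free_to_dual u f - free_to_dual u (lip0_mult (\<rho> n) f)\<bar> \<le> \<epsilon> * (1 - (1/2) ^ n)"
      by (rule approx)
    also have "\<dots> \<le> \<epsilon> * 1" using \<epsilon> by (intro mult_left_mono) auto
    finally show "\<bar>free_to_dual u f - free_to_dual u (lip0_mult (\<rho> n) f)\<bar> \<le> \<epsilon>" by simp
  qed
qed

text \<open>An Arzela-Ascoli argument: a net \<open>N\<close> of \<open>A\<close> of mesh
  \<open>\<eta> / 4\<close> reduces closeness on \<open>A\<close> to closeness of the values on
  \<open>N\<close>, which are bounded because the functions vanish at the base point.\<close>

lemma lip0_finite_net:
  fixes A :: "'a::pointed_metric_space set"
  assumes A: "compact A" and \<eta>: "0 < \<eta>"
  obtains H where "finite H" "\<And>h. h \<in> H \<Longrightarrow> norm h \<le> 1"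
    "\<And>f. norm f \<le> 1 \<Longrightarrow> \<exists>h\<in>H. \<forall>x\<in>A. \<bar>lip0_apply f x - lip0_apply h x\<bar> \<le> \<eta>"
proof -
  obtain N where N: "finite N" "A \<subseteq> (\<Union>a\<in>N. ball a (\<eta> / 4))"
    using A \<eta> unfolding compact_eq_totally_bounded by (metis zero_less_divide_iff zero_less_numeral)
  have lip1: "\<bar>lip0_apply f x - lip0_apply f y\<bar> \<le> dist x y" if "norm f \<le> 1" for f :: "'a lip0" and x y
    using lip0_diff_le[of f x y] mult_right_mono[OF that, of "dist x y"] by simp
  have bound: "\<bar>lip0_apply f a\<bar> \<le> (\<Sum>z\<in>N. dist z base_point)" if "f \<in> {f. norm f \<le> 1}" "a \<in> N" for f :: "'a lip0" and a
    using lip1[of f a base_point] that N(1) member_le_sum[of a N "\<lambda>z. dist z base_point"] by simp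
  have \<eta>4: "0 < \<eta> / 4" using \<eta> by simp
  obtain H :: "'a lip0 set" where H: "finite H" "H \<subseteq> {f. norm f \<le> 1}"
    "\<And>f. f \<in> {f. norm f \<le> 1} \<Longrightarrow> \<exists>h\<in>H. \<forall>a\<in>N. \<bar>lip0_apply f a - lip0_apply h a\<bar> < \<eta> / 4"
    by (rule bounded_finite_net[OF N(1)], erule (1) bound, rule \<eta>4, rule that; assumption)
  show thesis
  proof (rule that[OF H(1)])
    show "norm h \<le> 1" if "h \<in> H" for h using H(2) that by blast
    fix f :: "'a lip0" assume f: "norm f \<le> 1"
    then obtain h where h: "h \<in> H" "\<forall>a\<in>N. \<bar>lip0_apply f a - lip0_apply h a\<bar> < \<eta> / 4"
      using H(3)[of f] by auto
    have "\<bar>lip0_apply f x - lip0_apply h x\<bar> \<le> \<eta>" if "x \<in> A" for x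
    proof -
      obtain a where a: "a \<in> N" "dist a x < \<eta> / 4" using N(2) \<open>x \<in> A\<close> by auto
      have "\<bar>lip0_apply f x - lip0_apply f a\<bar> \<le> dist a x" "\<bar>lip0_apply h x - lip0_apply h a\<bar> \<le> dist a x"
        using lip1[OF f, of x a] lip1[of h x a] h(1) H(2) by (auto simp: dist_commute)
      moreover have "\<bar>lip0_apply f a - lip0_apply h a\<bar> < \<eta> / 4" using a(1) h(2) by blast
      ultimately show ?thesis using a(2) \<eta> by linarith
    qed
    with h(1) show "\<exists>h\<in>H. \<forall>x\<in>A. \<bar>lip0_apply f x - lip0_apply h x\<bar> \<le> \<eta>" by blast
  qed
qed

section \<open>Total boundedness of (V*)-sets\<close>

text \<open>Group \<open>\<Gamma>\<close> by approximate values on \<open>H\<close>. The finitely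
  many representatives form no \<open>e\<close>-net, so some \<open>u\<close> is far from all of
  them, including one \<open>v\<close> with nearly the same values.\<close>

lemma V_star_set_almost_equal_pair:
  fixes \<Gamma> :: "'a::pointed_metric_space lipschitz_free set"
  assumes \<Gamma>: "V_star_set \<Gamma>" and not_tb: "\<nexists>k. finite k \<and> \<Gamma> \<subseteq> (\<Union>u\<in>k. ball u e)"
    and H: "finite H" and \<kappa>: "0 < \<kappa>"
  obtains u v where "u \<in> \<Gamma>" "v \<in> \<Gamma>" "e \<le> norm (u - v)"
    "\<And>h. h \<in> H \<Longrightarrow> \<bar>free_to_dual u h - free_to_dual v h\<bar> < \<kappa>"
proof -
  obtain R where R: "0 \<le> R" "\<And>u. u \<in> \<Gamma> \<Longrightarrow> norm u \<le> R"
    using V_star_set_bounded[OF \<Gamma>] by blast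
  have bound: "\<bar>free_to_dual u h\<bar> \<le> R * (\<Sum>h\<in>H. norm h)" if "u \<in> \<Gamma>" "h \<in> H" for u h
  proof -
    have "\<bar>free_to_dual u h\<bar> \<le> norm u * norm h"
      using norm_blinfun[of "free_to_dual u" h] by (simp add: norm_lipschitz_free.rep_eq)
    also have "\<dots> \<le> R * (\<Sum>h\<in>H. norm h)"
      using R that H by (intro mult_mono member_le_sum) auto
    finally show ?thesis .
  qed
  obtain K where K: "finite K" "K \<subseteq> \<Gamma>"
      "\<And>u. u \<in> \<Gamma> \<Longrightarrow> \<exists>v\<in>K. \<forall>h\<in>H. \<bar>free_to_dual u h - free_to_dual v h\<bar> < \<kappa>"
    by (rule bounded_finite_net[OF H], erule (1) bound, rule \<kappa>, rule that; assumption)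
  have "\<not> \<Gamma> \<subseteq> (\<Union>u\<in>K. ball u e)" using not_tb K(1) by blast
  then obtain u where u: "u \<in> \<Gamma>" "u \<notin> (\<Union>v\<in>K. ball v e)" by blast
  obtain v where v: "v \<in> K" "\<forall>h\<in>H. \<bar>free_to_dual u h - free_to_dual v h\<bar> < \<kappa>"
    using K(3)[OF u(1)] by blast
  show thesis
  proof (rule that[of u v])
    show "e \<le> norm (u - v)"
      using u(2) v(1) by (auto simp: dist_norm norm_minus_commute not_less)
  qed (use u v K(2) in auto)
qed

text \<open>Turns a function controlled on \<open>A\<close> alone into a Lipschitz function on the
  whole space.\<close>

lemma extend_by_multiplier:
  assumes g: "\<And>x y. x \<in> A \<Longrightarrow> y \<in> A \<Longrightarrow> \<bar>g x - g y\<bar> \<le> dist x y" "g base_point = 0"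
    and A: "base_point \<in> A" and \<theta>: "lip_multiplier B \<theta>" "\<And>x. x \<notin> A \<Longrightarrow> \<theta> x = 0"
  shows "lip0_apply (Lip0 (\<lambda>x. \<theta> x * g x)) x = \<theta> x * g x" "norm (Lip0 (\<lambda>x. \<theta> x * g x)) \<le> 1 + B"
proof -
  have "\<bar>\<theta> x * g x - \<theta> y * g y\<bar> \<le> (1 + B) * dist x y" for x y
    using sum_lipschitz_multiplier[of 1 A "\<lambda>_. g" "{()}" B \<theta> x y] assms by simp
  moreover have "0 \<le> 1 + B" using \<theta>(1) by (simp add: lip_multiplier_def)
  ultimately show "lip0_apply (Lip0 (\<lambda>x. \<theta> x * g x)) x = \<theta> x * g x" "norm (Lip0 (\<lambda>x. \<theta> x * g x)) \<le> 1 + B"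
    using g(2) by (simp_all add: lip0_apply_Lip0)
qed

text \<open>Take a pair nearly equal on the cut-off net \<open>H\<close>, with difference
  \<open>w\<close>, then \<open>f\<close> of norm at most 1 on which \<open>w\<close> exceeds
  \<open>3 * e / 4\<close>, and a net element \<open>h\<close> close to \<open>f\<close> on
  \<open>A\<close>. Half of \<open>f - h\<close> is small on \<open>A\<close>, is still detected by
  \<open>w\<close> after cutting off, and can be flattened at little cost.\<close>

lemma small_flat_hump:
  fixes \<Gamma> :: "'a::pointed_metric_space lipschitz_free set"
  assumes A: "compact A" "purely_1_unrectifiable A" "base_point \<in> A"
    and \<theta>: "lip_multiplier B \<theta>" "\<And>x. x \<notin> A \<Longrightarrow> \<theta> x = 0"
    and \<Gamma>: "V_star_set \<Gamma>" and not_tb: "\<nexists>k. finite k \<and> \<Gamma> \<subseteq> (\<Union>u\<in>k. ball u e)"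
    and tight: "\<And>u f. u \<in> \<Gamma> \<Longrightarrow> norm f \<le> 1 \<Longrightarrow>
      \<bar>free_to_dual u f - free_to_dual u (lip0_mult \<theta> f)\<bar> \<le> e / 8"
    and e: "0 < e" and s: "0 < s"
  obtains g u v where "u \<in> \<Gamma>" "v \<in> \<Gamma>" "g base_point = 0"
    "\<And>x. x \<in> A \<Longrightarrow> \<bar>g x\<bar> \<le> s"
    "\<And>x y. x \<in> A \<Longrightarrow> y \<in> A \<Longrightarrow> \<bar>g x - g y\<bar> \<le> dist x y"
    "little_lipschitz_on A (\<lambda>x y. \<bar>g x - g y\<bar>)"
    "e / 16 \<le> free_to_dual (u - v) (Lip0 (\<lambda>x. \<theta> x * g x))"
proof -
  have B: "0 \<le> B" and \<theta>01: "0 \<le> \<theta> x" "\<theta> x \<le> 1" for x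
    using \<theta>(1) by (auto simp: lip_multiplier_def)
  obtain H :: "'a lip0 set" where H: "finite H" "\<And>h. h \<in> H \<Longrightarrow> norm h \<le> 1"
    "\<And>f. norm f \<le> 1 \<Longrightarrow> \<exists>h\<in>H. \<forall>x\<in>A. \<bar>lip0_apply f x - lip0_apply h x\<bar> \<le> s"
    using lip0_finite_net[OF A(1) s] by blast
  have "finite (lip0_mult \<theta> ` H)" "0 < e / 4" using H(1) e by auto
  then obtain u v where uv: "u \<in> \<Gamma>" "v \<in> \<Gamma>" "e \<le> norm (u - v)"
    "\<And>h. h \<in> lip0_mult \<theta> ` H \<Longrightarrow> \<bar>free_to_dual u h - free_to_dual v h\<bar> < e / 4"
    by (rule V_star_set_almost_equal_pair[OF \<Gamma> not_tb]) blast
  define w where "w = u - v"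
  have w: "free_to_dual w f = free_to_dual u f - free_to_dual v f" for f
    by (simp add: w_def minus_lipschitz_free.rep_eq blinfun.diff_left)
  have "0 \<le> 3 * e / 4" "3 * e / 4 < norm (free_to_dual w)"
    using e uv(3) by (auto simp: w_def norm_lipschitz_free.rep_eq[symmetric])
  then obtain f where f: "norm f \<le> 1" "3 * e / 4 < free_to_dual w f"
    by (rule blinfun_norm_witness)
  obtain h where h: "h \<in> H" "\<forall>x\<in>A. \<bar>lip0_apply f x - lip0_apply h x\<bar> \<le> s"
    using H(3)[OF f(1)] by blast
  define f' where "f' = (1/2) *\<^sub>R (f - h)"
  have f'_apply: "lip0_apply f' x = (lip0_apply f x - lip0_apply h x) / 2" for x
    by (simp add: f'_def scaleR_lip0.rep_eq minus_lip0.rep_eq)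
  have f'_norm: "norm f' \<le> 1"
    using norm_triangle_ineq4[of f h] f(1) H(2)[OF h(1)] by (simp add: f'_def)
  have f'_lip: "\<bar>lip0_apply f' x - lip0_apply f' y\<bar> \<le> dist x y" for x y
    using lip0_diff_le[of f' x y] mult_right_mono[OF f'_norm, of "dist x y"] by simp
  have "lip0_mult \<theta> f' = (1/2) *\<^sub>R (lip0_mult \<theta> f - lip0_mult \<theta> h)"
    by (rule lip0_eqI)
      (simp add: lip0_mult(1)[OF \<theta>(1)] f'_apply scaleR_lip0.rep_eq minus_lip0.rep_eq right_diff_distrib)
  then have "free_to_dual w (lip0_mult \<theta> f')
      = (free_to_dual w (lip0_mult \<theta> f) - free_to_dual w (lip0_mult \<theta> h)) / 2"
    by (simp add: blinfun.scaleR_right blinfun.diff_right)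
  moreover have "free_to_dual w (lip0_mult \<theta> h) < e / 4"
    using uv(4)[OF imageI[OF h(1)]] unfolding w by linarith
  \<comment> \<open>Tightness costs \<open>e / 8\<close> for each of \<open>u\<close> and
    \<open>v\<close>.\<close>
  moreover have "e / 2 < free_to_dual w (lip0_mult \<theta> f)"
    using tight[OF uv(1) f(1)] tight[OF uv(2) f(1)] f(2) e unfolding w by linarith
  ultimately have big: "e / 8 < free_to_dual w (lip0_mult \<theta> f')"
    by simp
  \<comment> \<open>Flattening may lose \<open>e / 16\<close>. The error has norm at most
    \<open>2 * (1 + B)\<close>, which contributes \<open>e / 32\<close>; its values on
    \<open>E\<close> contribute another \<open>e / 32\<close> through \<open>\<eta>\<close>.\<close>
  have "0 < e / (64 * (1 + B))" using e B by simp
  then obtain E D where D: "finite E" "0 \<le> D"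
    "\<And>h s. 0 \<le> s \<Longrightarrow> (\<And>x. x \<in> E \<Longrightarrow> \<bar>lip0_apply h x\<bar> \<le> s) \<Longrightarrow>
      \<bar>free_to_dual w h\<bar> \<le> e / (64 * (1 + B)) * norm h + D * s"
    by (rule free_finite_support[where u = w]) blast
  \<comment> \<open>\<open>s / 4\<close> keeps \<open>g\<close> below \<open>s\<close>, as the shift
    to \<open>g base_point = 0\<close> doubles the error \<open>\<eta>\<close>; \<open>D + 1\<close>
    stands in for \<open>D\<close>, which may be 0.\<close>
  define \<eta> where "\<eta> = min (s / 4) (e / (64 * (D + 1)))"
  have \<eta>: "\<eta> \<le> s / 4" "\<eta> \<le> e / (64 * (D + 1))" "0 < \<eta>"
    unfolding \<eta>_def by (rule min.cobounded1, rule min.cobounded2) (use s e D(2) in simp)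
  obtain g0 where g0: "\<And>x. x \<in> A \<Longrightarrow> \<bar>g0 x - lip0_apply f' x\<bar> \<le> \<eta>"
      "\<And>x y. x \<in> A \<Longrightarrow> y \<in> A \<Longrightarrow> \<bar>g0 x - g0 y\<bar> \<le> dist x y"
      "little_lipschitz_on A (\<lambda>x y. \<bar>g0 x - g0 y\<bar>)"
    by (rule flatten[OF A(1,2) f'_lip \<eta>(3)]) (assumption | rule that)+
  define g where "g x = g0 x - g0 base_point" for x
  have g_diff: "g x - g y = g0 x - g0 y" for x y by (simp add: g_def)
  have g_lip: "\<bar>g x - g y\<bar> \<le> dist x y" if "x \<in> A" "y \<in> A" for x y
    using g0(2)[OF that] by (simp add: g_diff)
  have g_near: "\<bar>g x - lip0_apply f' x\<bar> \<le> 2 * \<eta>" if "x \<in> A" for x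
    using g0(1)[OF that] g0(1)[OF A(3)] by (simp add: g_def)
  have g_base: "g base_point = 0" by (simp add: g_def)
  define F where "F = Lip0 (\<lambda>x. \<theta> x * g x)"
  have F: "lip0_apply F x = \<theta> x * g x" "norm F \<le> 1 + B" for x
    unfolding F_def using extend_by_multiplier[of A g B \<theta>, OF g_lip g_base A(3) \<theta>] by auto
  have nf: "norm (lip0_mult \<theta> f') \<le> 1 + B"
  proof -
    have "norm f' * (1 + B) \<le> 1 * (1 + B)" using f'_norm B by (intro mult_right_mono) auto
    then show ?thesis using lip0_mult(2)[OF \<theta>(1), of f'] by simp
  qed
  have "\<bar>free_to_dual w (lip0_mult \<theta> f' - F)\<bar>
      \<le> e / (64 * (1 + B)) * norm (lip0_mult \<theta> f' - F) + D * (2 * \<eta>)"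
  proof (rule D(3))
    fix x
    show "\<bar>lip0_apply (lip0_mult \<theta> f' - F) x\<bar> \<le> 2 * \<eta>"
    proof (cases "x \<in> A")
      case True
      have "\<bar>lip0_apply (lip0_mult \<theta> f' - F) x\<bar> = \<theta> x * \<bar>g x - lip0_apply f' x\<bar>"
        using \<theta>01[of x] by (simp add: minus_lip0.rep_eq lip0_mult(1)[OF \<theta>(1)] F(1)
          right_diff_distrib[symmetric] abs_mult abs_minus_commute)
      also have "\<dots> \<le> 1 * (2 * \<eta>)"
        using \<theta>01[of x] g_near[OF True] by (intro mult_mono) auto
      finally show ?thesis by simp
    next
      case False
      then show ?thesis
        using \<eta>(3) by (simp add: minus_lip0.rep_eq lip0_mult(1)[OF \<theta>(1)] F(1) \<theta>(2))
    qed
  qed (use \<eta>(3) in simp)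
  also have "\<dots> \<le> e / (64 * (1 + B)) * (2 * (1 + B)) + e / 32"
  proof (rule add_mono)
    show "e / (64 * (1 + B)) * norm (lip0_mult \<theta> f' - F) \<le> e / (64 * (1 + B)) * (2 * (1 + B))"
    proof (rule mult_left_mono)
      show "norm (lip0_mult \<theta> f' - F) \<le> 2 * (1 + B)"
        using norm_triangle_ineq4[of "lip0_mult \<theta> f'" F] nf F(2) by simp
    qed (use e B in simp)
    have "D * (2 * \<eta>) \<le> (D + 1) * (2 * (e / (64 * (D + 1))))"
      using D(2) \<eta> by (intro mult_mono) auto
    also have "\<dots> = e / 32" using D(2) by (simp add: divide_simps)
    finally show "D * (2 * \<eta>) \<le> e / 32" .
  qed
  also have "\<dots> = e / 16" using B by (simp add: field_simps)
  finally have "e / 16 \<le> free_to_dual w F"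
    using big unfolding blinfun.diff_right by linarith
  moreover have "\<bar>g x\<bar> \<le> s" if "x \<in> A" for x
  proof -
    have "\<bar>lip0_apply f' x\<bar> \<le> s / 2" using h(2) that by (simp add: f'_apply)
    with g_near[OF that] \<eta>(1) show ?thesis by linarith
  qed
  ultimately show thesis
    using g_lip g_base g0(3) uv(1,2)
    by (intro that[of u v g]) (simp_all add: w_def F_def g_diff)
qed

text \<open>Humps are chosen inductively, each small compared with the scale at which the earlier
  ones are flat, so that their differences sum to at most \<open>3 * dist x y\<close> on
  \<open>A\<close>. Cut off by \<open>\<theta>\<close>, they form a series tending to 0 uniformly on
  \<open>\<Gamma>\<close>, although each is at least \<open>e / 16\<close> on some difference of two
  elements.\<close>

lemma V_star_set_totally_bounded:
  fixes \<Gamma> :: "'a::pointed_metric_space lipschitz_free set"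
  assumes M: "complete (UNIV :: 'a set)" "locally compact (UNIV :: 'a set)"
      "purely_1_unrectifiable (UNIV :: 'a set)"
    and \<Gamma>: "V_star_set \<Gamma>" and e: "0 < e"
  shows "\<exists>k. finite k \<and> \<Gamma> \<subseteq> (\<Union>u\<in>k. ball u e)"
proof (rule ccontr)
  assume not_tb: "\<not> ?thesis"
  have "0 < e / 8" using e by simp
  then obtain A \<theta> B where A: "compact A" "base_point \<in> A" and \<theta>: "lip_multiplier B \<theta>" "\<And>x. x \<notin> A \<Longrightarrow> \<theta> x = 0"
    and tight: "\<And>u f. u \<in> \<Gamma> \<Longrightarrow> norm f \<le> 1 \<Longrightarrow>
      \<bar>free_to_dual u f - free_to_dual u (lip0_mult \<theta> f)\<bar> \<le> e / 8"
    by (rule V_star_set_tight[OF M(1,2) \<Gamma>]) blast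
  have B: "0 \<le> B" using \<theta>(1) by (simp add: lip_multiplier_def)
  have A': "purely_1_unrectifiable A"
    using M(3) unfolding purely_1_unrectifiable_def by blast
  define hump where "hump g \<longleftrightarrow> g base_point = 0 \<and> (\<forall>x\<in>A. \<forall>y\<in>A. \<bar>g x - g y\<bar> \<le> dist x y) \<and>
      little_lipschitz_on A (\<lambda>x y. \<bar>g x - g y\<bar>) \<and>
      (\<exists>u\<in>\<Gamma>. \<exists>v\<in>\<Gamma>. e / 16 \<le> free_to_dual (u - v) (Lip0 (\<lambda>x. \<theta> x * g x)))" for g
  have ex_hump: "\<exists>g. hump g \<and> (\<forall>x\<in>A. \<bar>g x\<bar> \<le> s)" if "0 < s" for s
  proof -
    obtain g u v where "u \<in> \<Gamma>" "v \<in> \<Gamma>" "g base_point = 0"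
      "\<And>x. x \<in> A \<Longrightarrow> \<bar>g x\<bar> \<le> s"
      "\<And>x y. x \<in> A \<Longrightarrow> y \<in> A \<Longrightarrow> \<bar>g x - g y\<bar> \<le> dist x y"
      "little_lipschitz_on A (\<lambda>x y. \<bar>g x - g y\<bar>)"
      "e / 16 \<le> free_to_dual (u - v) (Lip0 (\<lambda>x. \<theta> x * g x))"
      by (rule small_flat_hump[OF A(1) A' A(2) \<theta> \<Gamma> not_tb tight e \<open>0 < s\<close>]) (assumption | rule that)+
    then show ?thesis unfolding hump_def by blast
  qed
  \<comment> \<open>The first component of a state accumulates \<open>\<Sum>\<^sub>k \<bar>g\<^sub>k x - g\<^sub>k y\<bar>\<close>.\<close>
  define P where "P n z \<longleftrightarrow> hump (snd z) \<and> little_lipschitz_on A (fst z) \<and>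
      (\<forall>x\<in>A. \<forall>y\<in>A. fst z x y \<le> (3 - (1/2) ^ n) * dist x y) \<and>
      (n = 0 \<longrightarrow> fst z = (\<lambda>x y. \<bar>snd z x - snd z y\<bar>))"
    for n :: nat and z :: "('a \<Rightarrow> 'a \<Rightarrow> real) \<times> ('a \<Rightarrow> real)"
  define Q where "Q n z z' \<longleftrightarrow> fst z' = (\<lambda>x y. fst z x y + \<bar>snd z' x - snd z' y\<bar>)"
    for n :: nat and z z' :: "('a \<Rightarrow> 'a \<Rightarrow> real) \<times> ('a \<Rightarrow> real)"
  have "\<exists>z. P 0 z"
  proof -
    obtain g where g: "hump g" using ex_hump[of 1] by auto
    have "\<bar>g x - g y\<bar> \<le> 2 * dist x y" if "x \<in> A" "y \<in> A" for x y
    proof -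
      have "\<bar>g x - g y\<bar> \<le> dist x y" using g that by (simp add: hump_def)
      then show ?thesis using zero_le_dist[of x y] by linarith
    qed
    with g show ?thesis
      by (intro exI[of _ "(\<lambda>x y. \<bar>g x - g y\<bar>, g)"]) (auto simp: P_def hump_def)
  qed
  moreover have "\<exists>z'. P (Suc n) z' \<and> Q n z z'" if z: "P n z" for n z
  proof -
    define S where "S = fst z"
    have S: "little_lipschitz_on A S" "\<And>x y. x \<in> A \<Longrightarrow> y \<in> A \<Longrightarrow> S x y \<le> (3 - (1/2) ^ n) * dist x y"
      using z by (auto simp: P_def S_def)
    \<comment> \<open>Up to distance \<open>\<delta>\<close> the earlier humps together contribute
      at most \<open>dist x y\<close>, and the new one at most as much again. Beyond
      \<open>\<delta>\<close> the new hump, of size at most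
      \<open>\<delta> * (1/2) ^ (n + 2)\<close>, adds at most
      \<open>(1/2) ^ Suc n * dist x y\<close>. Hence the bound \<open>3 - (1/2) ^ n\<close>.\<close>
    obtain \<delta> where \<delta>: "0 < \<delta>" "\<And>x y. x \<in> A \<Longrightarrow> y \<in> A \<Longrightarrow> dist x y \<le> \<delta> \<Longrightarrow> S x y \<le> dist x y"
      using S(1) unfolding little_lipschitz_on_def by (metis mult_1 zero_less_one)
    have "0 < \<delta> * (1/2) ^ (n + 2)" using \<delta>(1) by simp
    then obtain g where g: "hump g" "\<And>x. x \<in> A \<Longrightarrow> \<bar>g x\<bar> \<le> \<delta> * (1/2) ^ (n + 2)"
      using ex_hump by blast
    have "S x y + \<bar>g x - g y\<bar> \<le> (3 - (1/2) ^ Suc n) * dist x y" if xy: "x \<in> A" "y \<in> A" for x y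
    proof (cases "dist x y \<le> \<delta>")
      case True
      have "\<bar>g x - g y\<bar> \<le> dist x y" using g(1) xy by (simp add: hump_def)
      then have "S x y + \<bar>g x - g y\<bar> \<le> 2 * dist x y"
        using \<delta>(2)[OF xy True] by simp
      also have "\<dots> \<le> (3 - (1/2) ^ Suc n) * dist x y"
      proof (rule mult_right_mono)
        have "(1/2 :: real) ^ Suc n \<le> 1" by (rule power_le_one) auto
        then show "2 \<le> 3 - (1/2 :: real) ^ Suc n" by linarith
      qed simp
      finally show ?thesis .
    next
      case False
      have "\<bar>g x - g y\<bar> \<le> 2 * (\<delta> * (1/2) ^ (n + 2))"
        using g(2)[OF xy(1)] g(2)[OF xy(2)] by linarith
      also have "\<dots> = (1/2) ^ Suc n * \<delta>" by simp
      also have "\<dots> \<le> (1/2) ^ Suc n * dist x y"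
        using False by (intro mult_left_mono) auto
      finally have "S x y + \<bar>g x - g y\<bar> \<le> (3 - (1/2) ^ n) * dist x y + (1/2) ^ Suc n * dist x y"
        using S(2)[OF xy] by linarith
      also have "\<dots> = (3 - (1/2) ^ Suc n) * dist x y" by (simp add: algebra_simps)
      finally show ?thesis .
    qed
    moreover have "little_lipschitz_on A (\<lambda>x y. S x y + \<bar>g x - g y\<bar>)"
      using S(1) g(1) by (intro little_lipschitz_on_add) (auto simp: hump_def)
    ultimately show ?thesis
      using g(1) by (intro exI[of _ "(\<lambda>x y. S x y + \<bar>g x - g y\<bar>, g)"]) (simp add: P_def Q_def S_def)
  qed
  ultimately obtain Z where PZ: "\<And>n. P n (Z n)" and QZ: "\<And>n. Q n (Z n) (Z (Suc n))"
    using dependent_nat_choice[of P Q] by metis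
  define g where "g n = snd (Z n)" for n
  have g: "hump (g n)" for n using PZ[of n] by (simp add: P_def g_def)
  have sum_eq: "(\<Sum>k<Suc n. \<bar>g k x - g k y\<bar>) = fst (Z n) x y" for n x y
  proof (induction n)
    case 0
    then show ?case using PZ[of 0] by (simp add: P_def g_def)
  next
    case (Suc n)
    then show ?case using QZ[of n] by (simp add: Q_def g_def)
  qed
  have sum3: "(\<Sum>k<n. \<bar>g k x - g k y\<bar>) \<le> 3 * dist x y" if "x \<in> A" "y \<in> A" for n x y
  proof -
    have "(\<Sum>k<n. \<bar>g k x - g k y\<bar>) \<le> (\<Sum>k<Suc n. \<bar>g k x - g k y\<bar>)" by simp
    also have "\<dots> \<le> (3 - (1/2) ^ n) * dist x y"
      using PZ[of n] that by (simp only: sum_eq) (simp add: P_def)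
    also have "\<dots> \<le> 3 * dist x y" by (intro mult_right_mono) auto
    finally show ?thesis .
  qed
  define F where "F n = Lip0 (\<lambda>x. \<theta> x * g n x)" for n
  have F_apply: "lip0_apply (F n) x = \<theta> x * g n x" for n x
    unfolding F_def using g[of n] by (intro extend_by_multiplier[OF _ _ A(2) \<theta>]) (auto simp: hump_def)
  have "sum_lipschitz (3 * (1 + B)) (\<lambda>k. lip0_apply (F k))"
    unfolding sum_lipschitz_def F_apply
    using g by (intro allI sum_lipschitz_multiplier[OF _ sum3 A(2) _ \<theta>]) (auto simp: hump_def)
  then obtain N where N: "\<forall>n\<ge>N. \<forall>u\<in>\<Gamma>. \<bar>free_to_dual u (F n)\<bar> < e / 32"
    using V_star_set_sum_lipschitz[OF \<Gamma>, of "3 * (1 + B)" F "e / 32"] B e by auto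
  obtain u v where "u \<in> \<Gamma>" "v \<in> \<Gamma>" "e / 16 \<le> free_to_dual (u - v) (F N)"
    using g[of N] by (auto simp: hump_def F_def)
  moreover from this N have "\<bar>free_to_dual u (F N)\<bar> < e / 32" "\<bar>free_to_dual v (F N)\<bar> < e / 32"
    by auto
  ultimately show False
    by (simp add: minus_lipschitz_free.rep_eq blinfun.diff_left)
qed

section \<open>The weak topology\<close>

lemma continuous_map_weak_topology_apply:
  fixes \<phi> :: "'x::real_normed_vector \<Rightarrow>\<^sub>L real"
  shows "continuous_map weak_topology euclidean (blinfun_apply \<phi>)"
proof -
  have "continuous_map euclidean euclidean (\<lambda>F :: ('x \<Rightarrow>\<^sub>L real) \<Rightarrow> real. F \<phi>)"
    by simp
  from continuous_map_pullback[OF this, of UNIV "\<lambda>x \<psi>. blinfun_apply \<psi> x"]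
  show ?thesis by (simp add: weak_topology_def o_def)
qed

lemma continuous_map_euclidean_weak_topology: "continuous_map euclidean weak_topology (\<lambda>x. x)"
  unfolding weak_topology_def
proof (rule continuous_map_pullback')
  have "continuous_on UNIV (\<lambda>x (\<phi> :: 'a \<Rightarrow>\<^sub>L real). blinfun_apply \<phi> x)"
    by (intro continuous_on_coordinatewise_then_product continuous_intros)
  then show "continuous_map euclidean euclidean ((\<lambda>x (\<phi> :: 'a \<Rightarrow>\<^sub>L real). blinfun_apply \<phi> x) \<circ> (\<lambda>x. x))"
    by (simp add: o_def)
qed simp

lemma topspace_weak_topology [simp]: "topspace weak_topology = UNIV"
  by (simp add: weak_topology_def topspace_pullback_topology)

text \<open>Distinct elements differ as functionals on the Lipschitz functions, so some
  \<open>lip0_eval f\<close> separates them.\<close>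

lemma Hausdorff_space_weak_topology_free:
  "Hausdorff_space (weak_topology :: 'a::pointed_metric_space lipschitz_free topology)"
  unfolding Hausdorff_space_def
proof (intro allI impI)
  fix u v :: "'a lipschitz_free"
  assume "u \<in> topspace weak_topology \<and> v \<in> topspace weak_topology \<and> u \<noteq> v"
  then have "free_to_dual u \<noteq> free_to_dual v" by (simp add: free_to_dual_inject)
  then obtain f where "free_to_dual u f \<noteq> free_to_dual v f" by (auto intro: blinfun_eqI)
  then have "lip0_eval f u \<noteq> lip0_eval f v" by (simp add: lip0_eval.rep_eq)
  then obtain U V where UV: "open U" "open V" "lip0_eval f u \<in> U" "lip0_eval f v \<in> V" "U \<inter> V = {}"
    by (metis hausdorff)
  have "openin weak_topology {w. lip0_eval f w \<in> W}" if "open W" for W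
    using openin_continuous_map_preimage[OF continuous_map_weak_topology_apply, of W "lip0_eval f"] that
    by simp
  with UV show "\<exists>U V. openin weak_topology U \<and> openin weak_topology V \<and> u \<in> U \<and> v \<in> V \<and> disjnt U V"
    by (intro exI[of _ "{w. lip0_eval f w \<in> U}"] exI[of _ "{w. lip0_eval f w \<in> V}"]) (auto simp: disjnt_def)
qed

text \<open>By total boundedness the norm closure of \<open>\<Gamma>\<close> is norm compact, hence
  weakly compact, and weakly closed because the weak topology is Hausdorff. It therefore contains
  the weak closure as a closed subset of a compact set.\<close>

theorem theorem2:
  assumes "complete (UNIV :: 'a::pointed_metric_space set)"
    and "locally compact (UNIV :: 'a set)"
    and "purely_1_unrectifiable (UNIV :: 'a set)"
  shows "property_V_star TYPE('a lipschitz_free)"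
  unfolding property_V_star_def relatively_weakly_compact_def
proof (intro allI impI)
  fix \<Gamma> :: "'a lipschitz_free set" assume "V_star_set \<Gamma>"
  then have "compact (closure \<Gamma>)"
    by (intro compact_closure_totally_bounded complete_UNIV V_star_set_totally_bounded assms)
  then have cpt: "compactin weak_topology (closure \<Gamma>)"
    using image_compactin[OF _ continuous_map_euclidean_weak_topology, of "closure \<Gamma>"] by simp
  then have "closedin weak_topology (closure \<Gamma>)"
    by (rule compactin_imp_closedin[OF Hausdorff_space_weak_topology_free])
  then have "weak_topology closure_of \<Gamma> \<subseteq> closure \<Gamma>"
    by (intro closure_of_minimal closure_subset)
  then show "compactin weak_topology (weak_topology closure_of \<Gamma>)"
    by (intro closed_compactin[OF cpt] closedin_closure_of)
qed

end
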